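(* Let $K$ be a field and $R=K[x_1,\ldots,x_n]$. Let $A$ be the incidence matrix of a clutter with vertex set $\{x_1,\ldots,x_n\}$ such that all rows and columns of $A$ are nonzero, let $v_1,\ldots,v_q$ be the column vectors of $A$, let $v_i^*=\mathbf{1}-v_i$, and let $A^*$ be the matrix with column vectors $v_1^*,\ldots,v_q^*$. If $w_1^*,\ldots,w_s^*$ is the set of all $\alpha\in\mathbb{N}^n$ such that $\alpha\leq v_i^*$ for some $i$, then the following conditions are equivalent: (a) the Rees algebra $R[It]$ is normal, where $I=(x^{v_1},\ldots,x^{v_q})$; (b) $S^*=K[x^{w_1^*}t,\ldots,x^{w_s^*}t]\subset R[t]$ is normal; (c) $\{-e_1,\ldots,-e_n,(v_1^*,1),\ldots,(v_q^*,1)\}\subset\mathbb{Z}^{n+1}$ is a Hilbert basis; (d) the system $x\geq 0;\ xA\geq\mathbf{1}$ has the integer rounding property; (e) the system $x\geq 0;\ xA^*\leq\mathbf{1}$ has the integer rounding property.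
   Context: A clutter with finite vertex set $X$ is a family of subsets of $X$ (edges), none of which is included in another. Its incidence matrix is the vertex-edge $\{0,1\}$-matrix whose columns are the characteristic vectors of the edges. $x^a:=x_1^{a_1}\cdots x_n^{a_n}$; $\mathbf{1}$ is the all-ones vector; $e_i$ is the $i$th unit vector of $\mathbb{R}^{n+1}$; vector inequalities are componentwise; $\langle\,,\rangle$ is the standard inner product. The Rees algebra is $R[It]=R\oplus It\oplus\cdots\oplus I^it^i\oplus\cdots\subset R[t]$, $t$ a new variable. Normal means integrally closed in its field of fractions. A finite set $\mathcal{H}\subset\mathbb{Z}^{m}$ is a Hilbert basis if $\mathbb{N}\mathcal{H}=\mathbb{R}_+\mathcal{H}\cap\mathbb{Z}^m$, where $\mathbb{N}\mathcal{H}$ is the semigroup of non-negative integer combinations of $\mathcal{H}$ and $\mathbb{R}_+\mathcal{H}$ the cone of non-negative real combinations. For a matrix $B$ with $q$ columns and entries in $\mathbb{N}$: the system $x\geq 0;\ xB\geq\mathbf{1}$ has the integer rounding property if $$\max\{\langle y,\mathbf{1}\rangle\mid By\leq w;\ y\in\mathbb{N}^q\}=\lfloor\max\{\langle y,\mathbf{1}\rangle\mid y\geq 0;\ By\leq w\}\rfloor$$ for each integral vector $w$ for which the right hand side is finite; the system $x\geq 0;\ xB\leq\mathbf{1}$ has the integer rounding property if $$\lceil\min\{\langle y,\mathbf{1}\rangle\mid y\geq 0;\ By\geq a\}\rceil=\min\{\langle y,\mathbf{1}\rangle\mid By\geq a;\ y\in\mathbb{N}^q\}$$ for each integral vector $a$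 for which $\min\{\langle y,\mathbf{1}\rangle\mid y\geq 0;\ By\geq a\}$ is finite. *)

theory Defs
  imports
    "HOL-Analysis.Analysis"
    "HOL-Library.Poly_Mapping"
    "HOL-Computational_Algebra.Polynomial_Factorial"
begin

section \<open>Clutters and incidence matrices\<close>

definition clutter :: "'a set \<Rightarrow> 'a set set \<Rightarrow> bool" where
  "clutter X E \<longleftrightarrow> finite X \<and> E \<subseteq> Pow X \<and> (\<forall>e\<in>E. \<forall>f\<in>E. e \<subseteq> f \<longrightarrow> e = f)"

text \<open>The bijection \<open>e\<close> lists the edges in some order, one column for each edge.\<close>

definition is_incidence_matrix :: "'n::finite set set \<Rightarrow> nat^'q::finite^'n \<Rightarrow> bool" where
  "is_incidence_matrix E A \<longleftrightarrow>
     (\<exists>e. bij_betw e (UNIV :: 'q set) E \<and> (\<forall>i j. A $ i $ j = (if i \<in> e j then 1 else 0)))"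

text \<open>The truncating subtraction on \<^typ>\<open>nat\<close> is harmless: this is only used for 0/1 matrices.\<close>

definition dual_matrix :: "nat^'q::finite^'n::finite \<Rightarrow> nat^'q^'n" where
  "dual_matrix A = (\<chi> i j. 1 - A $ i $ j)"


section \<open>Normal domains\<close>

definition integral_over :: "'a::comm_ring_1 set \<Rightarrow> 'a \<Rightarrow> bool" where
  "integral_over S z \<longleftrightarrow> (\<exists>p. lead_coeff p = 1 \<and> (\<forall>i. coeff p i \<in> S) \<and> poly p z = 0)"

text \<open>
  The field of fractions of a subring \<open>S\<close> of a domain, realised inside the field of
  fractions of that domain.
\<close>

definition fraction_field :: "'a::idom set \<Rightarrow> 'a fract set" where
  "fraction_field S = {Fract a b | a b. a \<in> S \<and> b \<in> S \<and> b \<noteq> 0}"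

definition normal_domain :: "'a::idom set \<Rightarrow> bool" where
  "normal_domain S \<longleftrightarrow>
     (\<forall>z\<in>fraction_field S. integral_over (to_fract ` S) z \<longrightarrow> z \<in> to_fract ` S)"


section \<open>Monomials, Rees algebras and generated subalgebras\<close>

text \<open>
  \<open>K[x\<^sub>i | i \<in> 'n]\<close> is the type of finitely supported maps from exponents \<open>'n \<Rightarrow>\<^sub>0 nat\<close>
  to \<open>K\<close>, and adjoining \<open>t\<close> gives univariate polynomials over it.
  The order on \<open>'n\<close> is only there because the library proves that this ring is an
  integral domain for linearly ordered index types.
\<close>

type_synonym ('n, 'k) mpoly_ring = "('n \<Rightarrow>\<^sub>0 nat) \<Rightarrow>\<^sub>0 'k"

definition mvar :: "'n \<Rightarrow> ('n, 'k::field) mpoly_ring" where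
  "mvar i = Poly_Mapping.single (Poly_Mapping.single i 1) 1"

definition mconst :: "'k::field \<Rightarrow> ('n, 'k) mpoly_ring" where
  "mconst c = Poly_Mapping.single 0 c"

definition xpow :: "nat^'n::{finite,linorder} \<Rightarrow> ('n, 'k::field) mpoly_ring" where
  "xpow a = (\<Prod>i\<in>UNIV. mvar i ^ (a $ i))"

definition ideal_generated :: "'a::comm_ring_1 set \<Rightarrow> 'a set" where
  "ideal_generated G = module.span (*) G"

primrec ideal_power :: "'a::comm_ring_1 set \<Rightarrow> nat \<Rightarrow> 'a set" where
  "ideal_power I 0 = UNIV"
| "ideal_power I (Suc k) = ideal_generated {a * b | a b. a \<in> I \<and> b \<in> ideal_power I k}"

definition rees_algebra :: "'a::comm_ring_1 set \<Rightarrow> 'a poly set" where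
  "rees_algebra I = {p. \<forall>k. coeff p k \<in> ideal_power I k}"

inductive_set subring_generated :: "'a::ring_1 set \<Rightarrow> 'a set" for G where
  gen: "a \<in> G \<Longrightarrow> a \<in> subring_generated G"
| one: "1 \<in> subring_generated G"
| minus: "a \<in> subring_generated G \<Longrightarrow> - a \<in> subring_generated G"
| add: "a \<in> subring_generated G \<Longrightarrow> b \<in> subring_generated G \<Longrightarrow> a + b \<in> subring_generated G"
| mult: "a \<in> subring_generated G \<Longrightarrow> b \<in> subring_generated G \<Longrightarrow> a * b \<in> subring_generated G"

text \<open>\<open>K[F]\<close> for a subset \<open>F\<close> of \<open>K[x\<^sub>1, \<dots>, x\<^sub>n][t]\<close>.\<close>

definition K_subalgebra ::
  "('n::{finite,linorder}, 'k::field) mpoly_ring poly set \<Rightarrow> ('n, 'k) mpoly_ring poly set" where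
  "K_subalgebra F = subring_generated (range (\<lambda>c. [:mconst c:]) \<union> F)"


section \<open>Hilbert bases\<close>

definition int_lattice :: "(real^'m::finite) set" where
  "int_lattice = {z. \<forall>k. z $ k \<in> \<int>}"

definition nat_combinations :: "(real^'m::finite) set \<Rightarrow> (real^'m) set" where
  "nat_combinations H = {\<Sum>h\<in>H. of_nat (c h) *\<^sub>R h | c :: real^'m \<Rightarrow> nat. True}"

definition real_cone :: "(real^'m::finite) set \<Rightarrow> (real^'m) set" where
  "real_cone H = {\<Sum>h\<in>H. c h *\<^sub>R h | c. \<forall>h\<in>H. 0 \<le> c h}"

definition hilbert_basis :: "(real^'m::finite) set \<Rightarrow> bool" where
  "hilbert_basis H \<longleftrightarrow>
     finite H \<and> H \<subseteq> int_lattice \<and> nat_combinations H = real_cone H \<inter> int_lattice"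

text \<open>
  \<open>\<real>\<^sup>n\<^sup>+\<^sup>1\<close> is \<^typ>\<open>real^('n option)\<close>, with \<^const>\<open>None\<close> as index of the last coordinate;
  \<open>append_one v\<close> is \<open>(v, 1)\<close>.
\<close>

definition append_one :: "nat^'n::finite \<Rightarrow> real^('n option)" where
  "append_one v = (\<chi> k. case k of Some i \<Rightarrow> real (v $ i) | None \<Rightarrow> 1)"


section \<open>Integer rounding properties\<close>

definition is_max :: "real set \<Rightarrow> real \<Rightarrow> bool" where
  "is_max V m \<longleftrightarrow> m \<in> V \<and> (\<forall>v\<in>V. v \<le> m)"

definition is_min :: "real set \<Rightarrow> real \<Rightarrow> bool" where
  "is_min V m \<longleftrightarrow> m \<in> V \<and> (\<forall>v\<in>V. m \<le> v)"

definition real_matrix :: "nat^'q::finite^'n::finite \<Rightarrow> real^'q^'n" where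
  "real_matrix B = (\<chi> i j. real (B $ i $ j))"

definition nat_vectors :: "(real^'q::finite) set" where
  "nat_vectors = {y. \<forall>j. y $ j \<in> \<nat>}"

text \<open>
  The suffix refers to the system \<open>x \<ge> 0; xB \<ge> 1\<close> or \<open>x \<ge> 0; xB \<le> 1\<close>; its integer
  rounding property is about the dual linear program, whose variable is \<open>y\<close>. The vector \<open>1\<close> is the all-ones vector and \<open>\<le>\<close> is componentwise.
  The optimum \<open>M\<close> of a real linear program is finite exactly if it exists as a real
  number, since a feasible linear program with bounded objective attains its optimum.
\<close>

definition integer_rounding_ge :: "nat^'q::finite^'n::finite \<Rightarrow> bool" where
  "integer_rounding_ge B \<longleftrightarrow>
     (\<forall>w\<in>int_lattice. \<forall>M.
        is_max {y \<bullet> 1 | y. 0 \<le> y \<and> real_matrix B *v y \<le> w} M \<longrightarrow>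
        is_max {y \<bullet> 1 | y. real_matrix B *v y \<le> w \<and> y \<in> nat_vectors} (of_int \<lfloor>M\<rfloor>))"

definition integer_rounding_le :: "nat^'q::finite^'n::finite \<Rightarrow> bool" where
  "integer_rounding_le B \<longleftrightarrow>
     (\<forall>a\<in>int_lattice. \<forall>M.
        is_min {y \<bullet> 1 | y. 0 \<le> y \<and> a \<le> real_matrix B *v y} M \<longrightarrow>
        is_min {y \<bullet> 1 | y. a \<le> real_matrix B *v y \<and> y \<in> nat_vectors} (of_int \<lceil>M\<rceil>))"

end

(*
  Writing A* y = <y, 1> 1 - A y, all five conditions express the same decomposition property: if an
  integral vector w and a natural number b admit a real y >= 0 with <y, 1> = b and A y <= w, then
  they admit such a y with natural entries. For the integer rounding properties this is a matter of
  scaling y and of attaining the optimum on a compact set.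

  Both algebras are spanned by the monomials whose exponents lie in a submonoid of N^(n+1). If such
  an algebra is normal and (w, b) lies in the real cone, simultaneous Diophantine approximation puts
  a positive multiple of (w, b) into the monoid, so the monomial of (w, b) is integral. Conversely,
  if f / g is integral, then c f^k / g^k stays in the algebra for some fixed c and all k; since the
  cone is closed, the quotient of the leading monomials of f and g lies in the cone, hence in the
  monoid, and one divides f by g term by term.
*)

theory Submission
  imports Defs "HOL-Analysis.Kronecker_Approximation_Theorem"
begin

section \<open>Integral points of the cone\<close>

text \<open>One matrix \<open>L\<close> carries both algebras: a lower bound
  \<open>a \<le> B y\<close> becomes an upper bound after a change of sign, so the Diophantine,
  compactness and normality arguments are given once. The coordinate sum is fixed at
  \<open>b\<close>, not merely bounded by it, because it is the degree in t, and because only for a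
  fixed sum does passing to the dual matrix amount to translating \<open>w\<close>. The delicate
  point in deducing decomposability from normality is that normality speaks only about quotients of
  elements of the algebra and about genuine exponents. An integral \<open>w\<close> may have entries
  of the wrong sign, so it is first replaced by an admissible exponent, and this exponent is then
  written as a difference of two points of the monoid. In the other direction the obstacle is that
  an integral fraction is a quotient of arbitrary elements, not of monomials. Division term by term
  works because the multiplier c survives the removal of a term and because the lexicographic order
  on exponents in finitely many variables is well-founded.\<close>

definition real_feasible :: "real^'q::finite^'n::finite \<Rightarrow> real^'n \<Rightarrow> real \<Rightarrow> bool" where
  "real_feasible L w b \<longleftrightarrow> (\<exists>y. 0 \<le> y \<and> y \<bullet> 1 = b \<and> L *v y \<le> w)"

definition nat_feasible :: "real^'q::finite^'n::finite \<Rightarrow> real^'n \<Rightarrow> real \<Rightarrow> bool" where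
  "nat_feasible L w b \<longleftrightarrow> (\<exists>y\<in>nat_vectors. y \<bullet> 1 = b \<and> L *v y \<le> w)"

definition decomposable :: "real^'q::finite^'n::finite \<Rightarrow> bool" where
  "decomposable L \<longleftrightarrow>
     (\<forall>w\<in>int_lattice. \<forall>b::nat. real_feasible L w (real b) \<longrightarrow> nat_feasible L w (real b))"

section \<open>Natural vectors and their coordinate sums\<close>

lemma inner_one: "(y::real^'q::finite) \<bullet> 1 = (\<Sum>j\<in>UNIV. y $ j)"
  by (simp add: inner_vec_def)

lemma nat_vectors_iff: "y \<in> nat_vectors \<longleftrightarrow> y \<in> int_lattice \<and> 0 \<le> y"
  unfolding nat_vectors_def int_lattice_def less_eq_vec_def Nats_altdef2 by auto

lemma nat_vectors_add: "x \<in> nat_vectors \<Longrightarrow> y \<in> nat_vectors \<Longrightarrow> x + y \<in> nat_vectors"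
  by (simp add: nat_vectors_def)

lemma zero_in_nat_vectors: "0 \<in> nat_vectors"
  by (simp add: nat_vectors_def)

lemma axis_in_nat_vectors: "axis j 1 \<in> nat_vectors"
  by (simp add: nat_vectors_def axis_def)

lemma nat_vectors_inner_one: "y \<in> nat_vectors \<Longrightarrow> y \<bullet> 1 \<in> \<nat>"
  unfolding nat_vectors_iff int_lattice_def less_eq_vec_def inner_one Nats_altdef2
  by (simp add: sum_nonneg Ints_sum)

lemma axis_inner_one: "axis j (1::real) \<bullet> 1 = 1"
  by (simp add: inner_one axis_def sum.delta)

text \<open>A positive coordinate sum forces a positive entry. Splitting off a unit vector of
  \<open>u\<close> splits off one column of \<open>L *v u\<close>, hence one generator, so
  statements about degree \<open>k\<close> can be proved by induction.\<close>

lemma nat_vectors_pred: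
  assumes "u \<in> nat_vectors" and "u \<bullet> 1 = real (Suc k)"
  obtains j v where "v \<in> nat_vectors" "u = v + axis j 1" "v \<bullet> 1 = real k"
proof -
  have "(\<Sum>j\<in>UNIV. u $ j) \<noteq> 0" using assms(2) by (simp add: inner_one)
  then obtain j where "u $ j \<noteq> 0" by (meson sum.neutral)
  with assms(1) obtain m where m: "u $ j = real (Suc m)"
    unfolding nat_vectors_def Nats_def by (metis (mono_tags, lifting) mem_Collect_eq imageE not0_implies_Suc of_nat_0)
  define v where "v = u - axis j 1"
  have "v $ i \<in> \<nat>" for i
  proof (cases "i = j")
    case True then show ?thesis using m by (simp add: v_def axis_def)
  next
    case False then show ?thesis using assms(1) by (simp add: v_def axis_def nat_vectors_def)
  qed
  then have "v \<in> nat_vectors" by (simp add: nat_vectors_def)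
  moreover have "u = v + axis j 1" by (simp add: v_def)
  moreover have "v \<bullet> 1 = real k"
    using assms(2) by (simp add: v_def inner_diff_left axis_inner_one)
  ultimately show ?thesis by (rule that)
qed

lemma int_lattice_matrix_vector_mult:
  assumes "\<forall>i j. L $ i $ j \<in> \<int>" and "u \<in> int_lattice"
  shows "L *v u \<in> int_lattice"
  using assms by (auto simp: int_lattice_def matrix_vector_mult_def intro!: Ints_sum Ints_mult)

lemma int_le_if_less_add_one:
  fixes x y :: real
  assumes "x \<in> \<int>" "y \<in> \<int>" "x < y + 1"
  shows "x \<le> y"
  using assms by (auto elim!: Ints_cases)

text \<open>
  Simultaneous Diophantine approximation gives a multiple \<open>k y\<close> of a real solution that is so
  close to an integral vector that all the integral constraints survive rounding.
\<close>

lemma nat_feasible_multiple: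
  fixes L :: "real^'q::finite^'n::finite"
  assumes L: "\<forall>i j. L $ i $ j \<in> \<int>" and w: "w \<in> int_lattice"
    and feas: "real_feasible L w (real b)"
  obtains k where "k > 0" "nat_feasible L (real k *\<^sub>R w) (real (k * b))"
proof -
  obtain y where y: "0 \<le> y" "y \<bullet> 1 = real b" "L *v y \<le> w"
    using feas unfolding real_feasible_def by blast
  obtain h where h: "bij_betw h {0..<CARD('q)} (UNIV :: 'q set)"
    using ex_bij_betw_nat_finite[OF finite[of UNIV]] by blast
  \<comment> \<open>\<open>C\<close> bounds the l1-norms of the all-ones vector and of every row of
    \<open>L\<close>. With \<open>N > C\<close>, errors below \<open>1 / N\<close> in the
    coordinates change the coordinate sum and each entry of the product by less than 1.\<close>
  define C where "C = real CARD('q) + (\<Sum>i\<in>UNIV. \<Sum>j\<in>UNIV. \<bar>L $ i $ j\<bar>)"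
  obtain N where N: "C < real N" using reals_Archimedean2 by blast
  have C0: "real CARD('q) \<le> C" unfolding C_def by (simp add: sum_nonneg)
  have Crow: "(\<Sum>j\<in>UNIV. \<bar>L $ i $ j\<bar>) \<le> C" for i
  proof -
    have "(\<Sum>j\<in>UNIV. \<bar>L $ i $ j\<bar>) \<le> (\<Sum>i\<in>UNIV. \<Sum>j\<in>UNIV. \<bar>L $ i $ j\<bar>)"
      by (rule member_le_sum[where f = "\<lambda>i. \<Sum>j\<in>UNIV. \<bar>L $ i $ j\<bar>"]) (auto intro: sum_nonneg)
    then show ?thesis by (simp add: C_def)
  qed
  have "CARD('q) > 0" by simp
  with C0 N have N0: "N > 0" by linarith
  obtain k p where k: "0 < k"
    and p: "\<And>i. i < CARD('q) \<Longrightarrow> \<bar>of_int k * y $ h i - of_int (p i)\<bar> < 1 / real N"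
    using Dirichlet_approx_simult[OF N0, of "CARD('q)" "\<lambda>i. y $ h i"] by metis
  define u :: "real^'q" where "u = (\<chi> j. of_int (p (the_inv_into {0..<CARD('q)} h j)))"
  have close: "\<bar>of_int k * y $ j - u $ j\<bar> < 1 / real N" for j
  proof -
    have "the_inv_into {0..<CARD('q)} h j \<in> {0..<CARD('q)}"
      using h by (metis UNIV_I bij_betw_def subset_refl the_inv_into_into)
    moreover have "h (the_inv_into {0..<CARD('q)} h j) = j"
      using h by (metis UNIV_I bij_betw_def f_the_inv_into_f)
    ultimately show ?thesis using p[of "the_inv_into {0..<CARD('q)} h j"] by (simp add: u_def)
  qed
  have u_int: "u $ j \<in> \<int>" for j by (simp add: u_def)
  have N1: "1 / real N \<le> 1" using N0 by simp
  have "u $ j \<in> \<nat>" for j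
  proof -
    have "0 \<le> of_int k * y $ j" using y(1) k by (simp add: less_eq_vec_def)
    \<comment> \<open>An integer greater than -1 is nonnegative, so the approximation cannot leave
      the orthant.\<close>
    with close[of j] N1 have "0 < u $ j + 1" by linarith
    then have "0 \<le> u $ j" using int_le_if_less_add_one[OF _ u_int] by simp
    with u_int show ?thesis by (simp add: Nats_altdef2)
  qed
  then have uN: "u \<in> nat_vectors" by (simp add: nat_vectors_def)
  have uI: "u \<in> int_lattice" using u_int by (simp add: int_lattice_def)
  have sum_close: "\<bar>\<Sum>j\<in>UNIV. c j * (of_int k * y $ j - u $ j)\<bar> < 1"
    if "(\<Sum>j\<in>UNIV. \<bar>c j\<bar>) \<le> C" for c :: "'q \<Rightarrow> real"
  proof -
    have "\<bar>\<Sum>j\<in>UNIV. c j * (of_int k * y $ j - u $ j)\<bar> \<le> (\<Sum>j\<in>UNIV. \<bar>c j\<bar> * (1 / real N))"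
      by (rule order.trans[OF sum_abs]) (auto simp: abs_mult intro!: sum_mono mult_left_mono less_imp_le[OF close[unfolded divide_inverse, simplified]] simp: divide_inverse)
    also have "\<dots> = (\<Sum>j\<in>UNIV. \<bar>c j\<bar>) / real N" by (simp add: sum_divide_distrib)
    also have "\<dots> \<le> C / real N" using that by (simp add: divide_right_mono)
    also have "\<dots> < 1" using N N0 by simp
    finally show ?thesis .
  qed
  \<comment> \<open>All coefficients equal to 1: two integers at distance below 1 coincide, so the
    sum is preserved exactly and not just up to an inequality.\<close>
  have "\<bar>of_int k * real b - u \<bullet> 1\<bar> < 1"
    using sum_close[of "\<lambda>_. 1"] C0
    unfolding y(2)[symmetric] inner_one sum_distrib_left by (simp add: sum_subtractf)
  moreover have "u \<bullet> 1 \<in> \<int>" unfolding inner_one by (intro Ints_sum u_int)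
  moreover have "of_int k * real b \<in> \<int>" by (intro Ints_mult Ints_of_int Ints_of_nat)
  ultimately have ub: "u \<bullet> 1 = of_int k * real b"
    using int_le_if_less_add_one[of "u \<bullet> 1" "of_int k * real b"]
      int_le_if_less_add_one[of "of_int k * real b" "u \<bullet> 1"] by linarith
  have "(L *v u) $ i \<le> of_int k * w $ i" for i
  proof (rule int_le_if_less_add_one)
    show "(L *v u) $ i \<in> \<int>"
      using int_lattice_matrix_vector_mult[OF L uI] by (simp add: int_lattice_def)
    show "of_int k * w $ i \<in> \<int>" using w by (simp add: int_lattice_def)
    have "\<bar>of_int k * (L *v y) $ i - (L *v u) $ i\<bar> < 1"
      using sum_close[of "\<lambda>j. L $ i $ j"] Crow[of i]
      by (simp add: matrix_vector_mult_def sum_subtractf sum_distrib_left algebra_simps)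
    moreover have "of_int k * (L *v y) $ i \<le> of_int k * w $ i"
      using y(3) k by (simp add: less_eq_vec_def)
    ultimately show "(L *v u) $ i < of_int k * w $ i + 1" by linarith
  qed
  then have "nat_feasible L (real (nat k) *\<^sub>R w) (real (nat k * b))"
    unfolding nat_feasible_def using uN ub k by (intro bexI[of _ u]) (auto simp: less_eq_vec_def)
  then show ?thesis using that[of "nat k"] k by simp
qed

section \<open>Compactness, and closedness of the cone\<close>

lemma closed_matrix_le: "closed {y. L *v y \<le> (w::real^'n::finite)}"
  for L :: "real^'q::finite^'n"
  unfolding less_eq_vec_def by (intro closed_Collect_all closed_Collect_le continuous_intros)

lemma compact_bounded_nonneg: "compact {y::real^'q::finite. 0 \<le> y \<and> y \<bullet> 1 \<le> C}"
proof -
  have "{y::real^'q. 0 \<le> y \<and> y \<bullet> 1 \<le> C} = {y. \<forall>i. 0 \<le> y $ i} \<inter> {y. y \<bullet> 1 \<le> C}"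
    by (auto simp: less_eq_vec_def)
  moreover have "closed {y::real^'q. \<forall>i. 0 \<le> y $ i}" "closed {y::real^'q. y \<bullet> 1 \<le> C}"
    by (intro closed_Collect_all closed_Collect_le continuous_intros)+
  ultimately have "closed {y::real^'q. 0 \<le> y \<and> y \<bullet> 1 \<le> C}" by (simp add: closed_Int)
  moreover have "{y::real^'q. 0 \<le> y \<and> y \<bullet> 1 \<le> C} \<subseteq> cbox 0 (\<chi> _. C)"
  proof
    fix y :: "real^'q" assume "y \<in> {y. 0 \<le> y \<and> y \<bullet> 1 \<le> C}"
    then have y: "\<And>i. 0 \<le> y $ i" "(\<Sum>i\<in>UNIV. y $ i) \<le> C"
      by (auto simp: less_eq_vec_def inner_one)
    have "y $ i \<le> C" for i
      using y(2) member_le_sum[of i UNIV "\<lambda>i. y $ i"] y(1) by fastforce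
    with y(1) show "y \<in> cbox 0 (\<chi> _. C)" by (simp add: mem_box_cart)
  qed
  ultimately show ?thesis
    using bounded_subset[OF bounded_cbox] by (simp add: compact_eq_bounded_closed)
qed

text \<open>Division by the index makes the fixed summands \<open>w0\<close> and \<open>b0\<close>
  vanish in the limit, while the divided witnesses stay in a compact set; a limit point of them is a
  witness for \<open>w\<close> and \<open>b\<close>. This is the closedness of the cone in the form
  needed for a fixed multiplier c.\<close>

lemma real_feasible_limit:
  fixes L :: "real^'q::finite^'n::finite"
  assumes "\<And>k::nat. real_feasible L (w0 + real k *\<^sub>R w) (b0 + real k * b)"
  shows "real_feasible L w b"
proof -
  let ?K = "{y::real^'q. 0 \<le> y \<and> y \<bullet> 1 \<le> \<bar>b0\<bar> + b}"
  \<comment> \<open>The index is shifted by one because the witnesses are divided by it.\<close>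
  have "\<exists>y. 0 \<le> y \<and> y \<bullet> 1 = b0 + real (Suc k) * b \<and> L *v y \<le> w0 + real (Suc k) *\<^sub>R w" for k
    using assms[of "Suc k"] unfolding real_feasible_def by blast
  then obtain y where y: "\<And>k. 0 \<le> y k" "\<And>k. y k \<bullet> 1 = b0 + real (Suc k) * b"
    "\<And>k. L *v y k \<le> w0 + real (Suc k) *\<^sub>R w"
    by metis
  define z where "z k = (1 / real (Suc k)) *\<^sub>R y k" for k
  have z0: "0 \<le> z k" for k
    using y(1)[of k] by (simp add: z_def less_eq_vec_def)
  have zb: "z k \<bullet> 1 = b0 * inverse (real (Suc k)) + b" for k
    using y(2)[of k] by (simp add: z_def field_simps del: of_nat_Suc)
  have zw: "(L *v z k) $ i \<le> w0 $ i * inverse (real (Suc k)) + w $ i" for k i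
  proof -
    have "(L *v y k) $ i \<le> w0 $ i + real (Suc k) * w $ i"
      using y(3)[of k] by (simp add: less_eq_vec_def del: of_nat_Suc)
    then show ?thesis
      by (simp add: z_def matrix_vector_mult_scaleR field_simps del: of_nat_Suc)
  qed
  have zK: "z k \<in> ?K" for k
  proof -
    have "b0 * inverse (real (Suc k)) \<le> \<bar>b0\<bar> * 1"
      by (intro mult_mono) (auto simp: inverse_le_1_iff)
    then show ?thesis using z0[of k] unfolding mem_Collect_eq zb by linarith
  qed
  obtain l r where l: "l \<in> ?K" "strict_mono r" "(z \<circ> r) \<longlonglongrightarrow> l"
    using seq_compactE[OF compact_imp_seq_compact[OF compact_bounded_nonneg] allI[OF zK]] .
  have inv: "(\<lambda>k. inverse (real (Suc (r k)))) \<longlonglongrightarrow> 0"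
    using LIMSEQ_subseq_LIMSEQ[OF LIMSEQ_inverse_real_of_nat l(2)] by (simp add: o_def)
  have "(\<lambda>k. (z \<circ> r) k \<bullet> 1) \<longlonglongrightarrow> l \<bullet> 1" by (intro tendsto_intros l(3))
  moreover have "(\<lambda>k. (z \<circ> r) k \<bullet> 1) \<longlonglongrightarrow> b0 * 0 + b"
    unfolding o_def zb by (intro tendsto_intros inv)
  ultimately have lb: "l \<bullet> 1 = b" using LIMSEQ_unique by fastforce
  have "(L *v l) $ i \<le> w0 $ i * 0 + w $ i" for i
  proof (rule LIMSEQ_le)
    show "(\<lambda>k. (L *v (z \<circ> r) k) $ i) \<longlonglongrightarrow> (L *v l) $ i"
      by (intro tendsto_vec_nth bounded_linear.tendsto[OF matrix_vector_mul_bounded_linear] l(3))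
    show "(\<lambda>k. w0 $ i * inverse (real (Suc (r k))) + w $ i) \<longlonglongrightarrow> w0 $ i * 0 + w $ i"
      by (intro tendsto_intros inv)
    show "\<exists>N. \<forall>n\<ge>N. (L *v (z \<circ> r) n) $ i \<le> w0 $ i * inverse (real (Suc (r n))) + w $ i"
      using zw by auto
  qed
  with l(1) lb show ?thesis unfolding real_feasible_def
    by (intro exI[of _ l]) (auto simp: less_eq_vec_def)
qed

section \<open>Integer rounding\<close>

lemma matrix_vector_mult_mono:
  fixes B :: "real^'q::finite^'n::finite"
  assumes "\<And>i j. 0 \<le> B $ i $ j" and "x \<le> y"
  shows "B *v x \<le> B *v y"
  using assms by (auto simp: less_eq_vec_def matrix_vector_mult_def intro!: sum_mono mult_left_mono)

lemma matrix_vector_mult_axis: "(L::real^'q::finite^'n::finite) *v axis j 1 = column j L"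
  by (simp add: matrix_vector_mult_basis)

lemma uminus_matrix_vector_mult: "(- L) *v y = - (L *v y)"
  for L :: "real^'q::finite^'n::finite"
  by (simp add: matrix_vector_mult_def vec_eq_iff sum_negf)

lemma real_matrix_nonneg: "0 \<le> real_matrix B $ i $ j"
  by (simp add: real_matrix_def)

lemma real_feasible_uminus:
  "real_feasible (- L) (- a) b \<longleftrightarrow> (\<exists>y. 0 \<le> y \<and> y \<bullet> 1 = b \<and> a \<le> L *v y)"
  by (simp add: real_feasible_def uminus_matrix_vector_mult)

lemma nat_feasible_uminus:
  "nat_feasible (- L) (- a) b \<longleftrightarrow> (\<exists>y\<in>nat_vectors. y \<bullet> 1 = b \<and> a \<le> L *v y)"
  by (simp add: nat_feasible_def uminus_matrix_vector_mult)

lemma int_lattice_uminus: "w \<in> int_lattice \<Longrightarrow> - w \<in> int_lattice"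
  by (simp add: int_lattice_def)

lemma decomposable_uminus:
  "decomposable (- L) \<longleftrightarrow>
     (\<forall>a\<in>int_lattice. \<forall>b::nat. real_feasible (- L) (- a) (real b) \<longrightarrow> nat_feasible (- L) (- a) (real b))"
  unfolding decomposable_def using int_lattice_uminus by (metis add.inverse_inverse)

text \<open>Unit vectors are removed one at a time. This turns a natural optimum into a natural
  solution of any smaller prescribed sum, since a nonnegative matrix keeps the constraints valid
  below \<open>u\<close>.\<close>

lemma nat_vectors_below:
  assumes "u \<in> nat_vectors" "u \<bullet> 1 = real (b + d)"
  obtains v where "v \<in> nat_vectors" "v \<le> u" "v \<bullet> 1 = real b"
  using assms
proof (induction d arbitrary: u thesis)
  case 0 then show ?case by auto
next
  case (Suc d)
  obtain j u' where u': "u' \<in> nat_vectors" "u = u' + axis j 1" "u' \<bullet> 1 = real (b + d)"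
    by (rule nat_vectors_pred[of u "b + d"]) (use Suc.prems in auto)
  obtain v where v: "v \<in> nat_vectors" "v \<le> u'" "v \<bullet> 1 = real b"
    using Suc.IH[of u'] u' by blast
  have "u' \<le> u" using u'(2) by (simp add: less_eq_vec_def axis_def)
  with v Suc.prems(1) show ?case by (meson order.trans)
qed

lemma inner_one_nonneg: "0 \<le> y \<Longrightarrow> 0 \<le> y \<bullet> (1::real^'q::finite)"
  by (simp add: inner_one less_eq_vec_def sum_nonneg)

text \<open>A nonzero column has an entry at least 1, so each coordinate of a feasible vector is
  bounded by some entry of \<open>w\<close>. This is what makes the maximum finite for every
  \<open>w\<close> that admits a feasible vector.\<close>

lemma compact_feasible_ge:
  fixes B :: "nat^'q::finite^'n::finite"
  assumes "\<forall>j. column j B \<noteq> 0"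
  shows "compact {y. 0 \<le> y \<and> real_matrix B *v y \<le> w}"
proof -
  define C where "C = real CARD('q) * (\<Sum>i\<in>UNIV. \<bar>w $ i\<bar>)"
  have "y \<bullet> 1 \<le> C" if y: "0 \<le> y" "real_matrix B *v y \<le> w" for y
  proof -
    have "y $ j \<le> (\<Sum>i\<in>UNIV. \<bar>w $ i\<bar>)" for j
    proof -
      obtain i where "B $ i $ j \<noteq> 0"
        using assms by (auto simp: vec_eq_iff column_def)
      then have "1 * y $ j \<le> real_matrix B $ i $ j * y $ j"
        using y(1) by (intro mult_right_mono) (auto simp: real_matrix_def less_eq_vec_def)
      also have "\<dots> \<le> (\<Sum>j\<in>UNIV. real_matrix B $ i $ j * y $ j)"
        using y(1) by (intro member_le_sum) (auto simp: real_matrix_def less_eq_vec_def)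
      also have "\<dots> = (real_matrix B *v y) $ i" by (simp add: matrix_vector_mult_def)
      also have "\<dots> \<le> w $ i" using y(2) by (simp add: less_eq_vec_def)
      also have "\<dots> \<le> \<bar>w $ i\<bar>" by simp
      also have "\<dots> \<le> (\<Sum>i\<in>UNIV. \<bar>w $ i\<bar>)" by (rule member_le_sum) auto
      finally show ?thesis by simp
    qed
    then have "(\<Sum>j\<in>UNIV. y $ j) \<le> C"
      unfolding C_def by (intro order.trans[OF sum_bounded_above]) auto
    then show ?thesis by (simp add: inner_one)
  qed
  then have "{y. 0 \<le> y \<and> real_matrix B *v y \<le> w}
      = {y. 0 \<le> y \<and> y \<bullet> 1 \<le> C} \<inter> {y. real_matrix B *v y \<le> w}"
    by auto
  then show ?thesis
    by (simp add: compact_Int_closed[OF compact_bounded_nonneg closed_matrix_le])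
qed

text \<open>For a nonnegative matrix solutions can be shrunk: a real optimum is scaled down to the
  rounded value, and a natural optimum loses unit vectors until its sum is \<open>b\<close>.\<close>

lemma integer_rounding_ge_iff_decomposable:
  fixes B :: "nat^'q::finite^'n::finite"
  assumes B: "\<forall>j. column j B \<noteq> 0"
  shows "integer_rounding_ge B \<longleftrightarrow> decomposable (real_matrix B)"
proof
  assume dec: "decomposable (real_matrix B)"
  show "integer_rounding_ge B"
    unfolding integer_rounding_ge_def
  proof (intro ballI allI impI)
    fix w :: "real^'n" and M
    assume w: "w \<in> int_lattice" and M: "is_max {y \<bullet> 1 |y. 0 \<le> y \<and> real_matrix B *v y \<le> w} M"
    from M obtain y0 where y0: "0 \<le> y0" "real_matrix B *v y0 \<le> w" "y0 \<bullet> 1 = M"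
      by (auto simp: is_max_def)
    have M0: "0 \<le> M" using inner_one_nonneg[OF y0(1)] y0(3) by simp
    \<comment> \<open>For \<open>M = 0\<close> division by zero yields \<open>c = 0\<close>, and
      \<open>c * M\<close> is still the floor of \<open>M\<close>.\<close>
    define c where "c = of_int \<lfloor>M\<rfloor> / M"
    have c: "0 \<le> c" "c \<le> 1" "c * M = of_int \<lfloor>M\<rfloor>"
      using M0 by (auto simp: c_def divide_le_eq_1)
    have "0 \<le> c *\<^sub>R y0" using y0(1) c(1) by (simp add: less_eq_vec_def)
    moreover have "real_matrix B *v (c *\<^sub>R y0) \<le> w"
    proof (rule order.trans[OF matrix_vector_mult_mono y0(2)])
      show "c *\<^sub>R y0 \<le> y0"
        using y0(1) c by (simp add: less_eq_vec_def mult_left_le_one_le)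
    qed (rule real_matrix_nonneg)
    moreover have "(c *\<^sub>R y0) \<bullet> 1 = real (nat \<lfloor>M\<rfloor>)" using c(3) y0(3) M0 by simp
    ultimately have "real_feasible (real_matrix B) w (real (nat \<lfloor>M\<rfloor>))"
      unfolding real_feasible_def by blast
    with dec w have "nat_feasible (real_matrix B) w (real (nat \<lfloor>M\<rfloor>))"
      unfolding decomposable_def by blast
    then obtain u where u: "u \<in> nat_vectors" "real_matrix B *v u \<le> w" "u \<bullet> 1 = of_int \<lfloor>M\<rfloor>"
      using M0 by (auto simp: nat_feasible_def)
    have "y \<bullet> 1 \<le> of_int \<lfloor>M\<rfloor>" if y: "real_matrix B *v y \<le> w" "y \<in> nat_vectors" for y
    proof -
      have "y \<bullet> 1 \<le> M" using M y by (auto simp: is_max_def nat_vectors_iff)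
      moreover have "y \<bullet> 1 \<in> \<int>" using nat_vectors_inner_one[OF y(2)] Nats_subset_Ints by blast
      ultimately show ?thesis by (auto elim!: Ints_cases simp: le_floor_iff)
    qed
    with u show "is_max {y \<bullet> 1 |y. real_matrix B *v y \<le> w \<and> y \<in> nat_vectors} (of_int \<lfloor>M\<rfloor>)"
      unfolding is_max_def by force
  qed
next
  assume rounding: "integer_rounding_ge B"
  show "decomposable (real_matrix B)"
    unfolding decomposable_def
  proof (intro ballI allI impI)
    fix w :: "real^'n" and b :: nat
    let ?F = "{y. 0 \<le> y \<and> real_matrix B *v y \<le> w}"
    assume w: "w \<in> int_lattice" and "real_feasible (real_matrix B) w (real b)"
    then obtain y where y: "y \<in> ?F" "y \<bullet> 1 = real b" by (auto simp: real_feasible_def)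
    \<comment> \<open>A feasible point of sum \<open>b\<close> only bounds the optimum from below.
      The rounding property needs an attained maximum, which compactness supplies.\<close>
    have "continuous_on ?F (\<lambda>y. y \<bullet> 1)" by (intro continuous_intros)
    then obtain z where z: "z \<in> ?F" "\<And>x. x \<in> ?F \<Longrightarrow> x \<bullet> 1 \<le> z \<bullet> 1"
      using continuous_attains_sup[OF compact_feasible_ge[OF B, of w]] y(1) by blast
    have "is_max {y \<bullet> 1 |y. 0 \<le> y \<and> real_matrix B *v y \<le> w} (z \<bullet> 1)"
      unfolding is_max_def using z by blast
    with rounding w have
      "is_max {y \<bullet> 1 |y. real_matrix B *v y \<le> w \<and> y \<in> nat_vectors} (of_int \<lfloor>z \<bullet> 1\<rfloor>)"
      unfolding integer_rounding_ge_def by blast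
    then obtain u where u: "real_matrix B *v u \<le> w" "u \<in> nat_vectors" "u \<bullet> 1 = of_int \<lfloor>z \<bullet> 1\<rfloor>"
      unfolding is_max_def by auto
    have "real b \<le> z \<bullet> 1" using z(2)[OF y(1)] y(2) by simp
    then have "int b \<le> \<lfloor>z \<bullet> 1\<rfloor>" by (simp add: le_floor_iff)
    then have "u \<bullet> 1 = real (b + nat (\<lfloor>z \<bullet> 1\<rfloor> - int b))" using u(3) by simp
    then obtain v where v: "v \<in> nat_vectors" "v \<le> u" "v \<bullet> 1 = real b"
      using nat_vectors_below u(2) by blast
    then have "real_matrix B *v v \<le> w"
      using matrix_vector_mult_mono[OF real_matrix_nonneg] u(1) order.trans by blast
    with v show "nat_feasible (real_matrix B) w (real b)"
      unfolding nat_feasible_def by blast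
  qed
qed

text \<open>For a nonnegative matrix, adding multiples of a unit vector preserves
  \<open>a \<le> B y\<close>, so sums can be raised at will: from \<open>M\<close> to its ceiling in
  one direction, from the natural optimum to \<open>b\<close> in the other.\<close>

lemma integer_rounding_le_iff_decomposable:
  fixes B :: "nat^'q::finite^'n::finite"
  shows "integer_rounding_le B \<longleftrightarrow> decomposable (- real_matrix B)"
proof
  assume dec: "decomposable (- real_matrix B)"
  show "integer_rounding_le B"
    unfolding integer_rounding_le_def
  proof (intro ballI allI impI)
    fix a :: "real^'n" and M
    assume a: "a \<in> int_lattice" and M: "is_min {y \<bullet> 1 |y. 0 \<le> y \<and> a \<le> real_matrix B *v y} M"
    from M obtain y0 where y0: "0 \<le> y0" "a \<le> real_matrix B *v y0" "y0 \<bullet> 1 = M"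
      by (auto simp: is_min_def)
    have M0: "0 \<le> M" using inner_one_nonneg[OF y0(1)] y0(3) by simp
    define y where "y = y0 + (of_int \<lceil>M\<rceil> - M) *\<^sub>R axis (SOME j. True) 1"
    have y0y: "y0 \<le> y" by (simp add: y_def less_eq_vec_def axis_def)
    then have "0 \<le> y" using y0(1) by (rule order.trans[rotated])
    moreover have "a \<le> real_matrix B *v y"
      using y0(2) matrix_vector_mult_mono[OF real_matrix_nonneg y0y] by (rule order.trans)
    moreover have "y \<bullet> 1 = real (nat \<lceil>M\<rceil>)"
      using y0(3) M0 by (simp add: y_def inner_add_left axis_inner_one)
    ultimately have "real_feasible (- real_matrix B) (- a) (real (nat \<lceil>M\<rceil>))"
      unfolding real_feasible_uminus by blast
    with dec a have "nat_feasible (- real_matrix B) (- a) (real (nat \<lceil>M\<rceil>))"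
      unfolding decomposable_uminus by blast
    then obtain u where u: "u \<in> nat_vectors" "a \<le> real_matrix B *v u" "u \<bullet> 1 = of_int \<lceil>M\<rceil>"
      using M0 by (auto simp: nat_feasible_uminus)
    have "of_int \<lceil>M\<rceil> \<le> y \<bullet> 1" if y: "a \<le> real_matrix B *v y" "y \<in> nat_vectors" for y
    proof -
      have "M \<le> y \<bullet> 1" using M y by (auto simp: is_min_def nat_vectors_iff)
      moreover have "y \<bullet> 1 \<in> \<int>" using nat_vectors_inner_one[OF y(2)] Nats_subset_Ints by blast
      ultimately show ?thesis by (auto elim!: Ints_cases simp: ceiling_le_iff)
    qed
    with u show "is_min {y \<bullet> 1 |y. a \<le> real_matrix B *v y \<and> y \<in> nat_vectors} (of_int \<lceil>M\<rceil>)"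
      unfolding is_min_def by force
  qed
next
  assume rounding: "integer_rounding_le B"
  show "decomposable (- real_matrix B)"
    unfolding decomposable_uminus
  proof (intro ballI allI impI)
    fix a :: "real^'n" and b :: nat
    \<comment> \<open>The feasible set itself is unbounded. Cutting it at sum \<open>b\<close> makes
      it compact and keeps the minimum, since the points cut off have a larger sum.\<close>
    let ?F = "{y. 0 \<le> y \<and> y \<bullet> 1 \<le> real b} \<inter> {y. (- real_matrix B) *v y \<le> - a}"
    assume a: "a \<in> int_lattice" and "real_feasible (- real_matrix B) (- a) (real b)"
    then obtain y where "0 \<le> y" "y \<bullet> 1 = real b" "(- real_matrix B) *v y \<le> - a"
      unfolding real_feasible_def by blast
    then have y: "y \<in> ?F" by simp
    have F: "x \<in> ?F \<longleftrightarrow> 0 \<le> x \<and> x \<bullet> 1 \<le> real b \<and> a \<le> real_matrix B *v x" for x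
      by (simp add: uminus_matrix_vector_mult)
    have "compact ?F" by (intro compact_Int_closed compact_bounded_nonneg closed_matrix_le)
    moreover have "continuous_on ?F (\<lambda>y. y \<bullet> 1)" by (intro continuous_intros)
    ultimately obtain z where z: "z \<in> ?F" "\<And>x. x \<in> ?F \<Longrightarrow> z \<bullet> 1 \<le> x \<bullet> 1"
      using y continuous_attains_inf[of ?F "\<lambda>y. y \<bullet> 1"] by blast
    have "z \<bullet> 1 \<le> x \<bullet> 1" if "0 \<le> x" "a \<le> real_matrix B *v x" for x
      using z F[of x] F[of z] that by (cases "x \<bullet> 1 \<le> real b") auto
    then have "is_min {y \<bullet> 1 |y. 0 \<le> y \<and> a \<le> real_matrix B *v y} (z \<bullet> 1)"
      unfolding is_min_def using z(1) unfolding F by blast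
    with rounding a have
      "is_min {y \<bullet> 1 |y. a \<le> real_matrix B *v y \<and> y \<in> nat_vectors} (of_int \<lceil>z \<bullet> 1\<rceil>)"
      unfolding integer_rounding_le_def by blast
    then obtain u where u: "a \<le> real_matrix B *v u" "u \<in> nat_vectors" "u \<bullet> 1 = of_int \<lceil>z \<bullet> 1\<rceil>"
      unfolding is_min_def by auto
    have zb: "\<lceil>z \<bullet> 1\<rceil> \<le> int b" using z(1) unfolding F by (simp add: ceiling_le_iff)
    define v where "v = u + real (nat (int b - \<lceil>z \<bullet> 1\<rceil>)) *\<^sub>R axis (SOME j. True) 1"
    have uv: "u \<le> v" by (simp add: v_def less_eq_vec_def axis_def)
    have "v \<in> nat_vectors"
      using u(2) by (auto simp: v_def nat_vectors_def axis_def)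
    moreover have "v \<bullet> 1 = real b"
      using u(3) zb by (simp add: v_def inner_add_left axis_inner_one)
    moreover have "a \<le> real_matrix B *v v"
      using u(1) matrix_vector_mult_mono[OF real_matrix_nonneg uv] by (rule order.trans)
    ultimately show "nat_feasible (- real_matrix B) (- a) (real b)"
      unfolding nat_feasible_uminus by blast
  qed
qed

section \<open>Complementing a 0/1 matrix\<close>

lemma dual_matrix_vector_mult:
  fixes A :: "nat^'q::finite^'n::finite"
  assumes "\<forall>i j. A $ i $ j \<le> 1"
  shows "real_matrix (dual_matrix A) *v y = (y \<bullet> 1) *\<^sub>R 1 - real_matrix A *v y"
  using assms
  by (simp add: vec_eq_iff matrix_vector_mult_def real_matrix_def dual_matrix_def inner_one
      of_nat_diff left_diff_distrib sum_subtractf)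

text \<open>Among vectors of coordinate sum \<open>b\<close> the two systems have the same solutions
  once \<open>w\<close> is translated by \<open>b\<close> times the all-ones vector, and this
  translation permutes the integer lattice.\<close>

lemma decomposable_dual_matrix:
  fixes A :: "nat^'q::finite^'n::finite"
  assumes A: "\<forall>i j. A $ i $ j \<le> 1"
  shows "decomposable (- real_matrix (dual_matrix A)) \<longleftrightarrow> decomposable (real_matrix A)"
proof -
  let ?D = "- real_matrix (dual_matrix A)"
  have *: "?D *v y \<le> w - (y \<bullet> 1) *\<^sub>R 1 \<longleftrightarrow> real_matrix A *v y \<le> w" for y w
    by (simp add: uminus_matrix_vector_mult dual_matrix_vector_mult[OF A])
  have "real_feasible ?D (w - b *\<^sub>R 1) b \<longleftrightarrow> real_feasible (real_matrix A) w b"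
    "nat_feasible ?D (w - b *\<^sub>R 1) b \<longleftrightarrow> nat_feasible (real_matrix A) w b" for w b
    unfolding real_feasible_def nat_feasible_def using * by blast+
  note shift = this
  have lat: "w - real b *\<^sub>R 1 \<in> int_lattice \<longleftrightarrow> w \<in> int_lattice" for w :: "real^'n" and b :: nat
  proof -
    have "x - real b \<in> \<int> \<longleftrightarrow> x \<in> \<int>" for x
      using Ints_add[of "x - real b" "real b"] by auto
    then show ?thesis by (simp add: int_lattice_def)
  qed
  show ?thesis
  proof
    assume D: "decomposable ?D"
    show "decomposable (real_matrix A)"
      using D lat shift unfolding decomposable_def by blast
  next
    assume "decomposable (real_matrix A)"
    then have "nat_feasible ?D (w - real b *\<^sub>R 1) (real b)"
      if "w - real b *\<^sub>R 1 \<in> int_lattice" "real_feasible ?D (w - real b *\<^sub>R 1) (real b)" for w b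
      using that unfolding shift lat decomposable_def by blast
    then show "decomposable ?D"
      unfolding decomposable_def by (metis add_diff_cancel_right')
  qed
qed

section \<open>Hilbert bases\<close>

lemma zero_in_real_cone: "0 \<in> real_cone H"
  unfolding real_cone_def by (auto intro!: exI[of _ "\<lambda>_. 0"])

lemma real_cone_add: "x \<in> real_cone H \<Longrightarrow> y \<in> real_cone H \<Longrightarrow> x + y \<in> real_cone H"
  unfolding real_cone_def
proof clarsimp
  fix c d :: "real^'a \<Rightarrow> real"
  assume "\<forall>h\<in>H. 0 \<le> c h" "\<forall>h\<in>H. 0 \<le> d h"
  then show "\<exists>e. (\<Sum>h\<in>H. c h *\<^sub>R h) + (\<Sum>h\<in>H. d h *\<^sub>R h) = (\<Sum>h\<in>H. e h *\<^sub>R h) \<and> (\<forall>h\<in>H. 0 \<le> e h)"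
    by (intro exI[of _ "\<lambda>h. c h + d h"]) (auto simp: scaleR_left_distrib sum.distrib)
qed

lemma scaleR_in_real_cone:
  assumes "finite H" "h \<in> H" "0 \<le> r"
  shows "r *\<^sub>R h \<in> real_cone H"
proof -
  have "(\<Sum>g\<in>H. (if g = h then r else 0) *\<^sub>R g) = (\<Sum>g\<in>H. if g = h then r *\<^sub>R g else 0)"
    by (rule sum.cong) auto
  also have "\<dots> = r *\<^sub>R h" using assms by (simp add: sum.delta)
  finally show ?thesis unfolding real_cone_def using assms(3)
    by (auto intro!: exI[of _ "\<lambda>g. if g = h then r else 0"])
qed

lemma real_cone_sum:
  assumes "finite H" "\<And>i. i \<in> J \<Longrightarrow> f i \<in> H" "\<And>i. i \<in> J \<Longrightarrow> 0 \<le> c i"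
  shows "(\<Sum>i\<in>J. c i *\<^sub>R f i) \<in> real_cone H"
  using assms(2,3)
  by (induction J rule: infinite_finite_induct)
     (auto intro: zero_in_real_cone real_cone_add scaleR_in_real_cone[OF assms(1)])

lemma zero_in_nat_combinations: "0 \<in> nat_combinations H"
  unfolding nat_combinations_def by (auto intro!: exI[of _ "\<lambda>_. 0"])

lemma nat_combinations_add:
  "x \<in> nat_combinations H \<Longrightarrow> y \<in> nat_combinations H \<Longrightarrow> x + y \<in> nat_combinations H"
  unfolding nat_combinations_def
proof clarsimp
  fix c d :: "real^'a \<Rightarrow> nat"
  show "\<exists>e. (\<Sum>h\<in>H. real (c h) *\<^sub>R h) + (\<Sum>h\<in>H. real (d h) *\<^sub>R h) = (\<Sum>h\<in>H. real (e h) *\<^sub>R h)"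
    by (intro exI[of _ "\<lambda>h. c h + d h"]) (auto simp: scaleR_left_distrib sum.distrib)
qed

lemma scaleR_in_nat_combinations:
  assumes "finite H" "h \<in> H" "r \<in> \<nat>"
  shows "r *\<^sub>R h \<in> nat_combinations H"
proof -
  obtain n where n: "r = real n" using assms(3) by (auto elim: Nats_cases)
  have "(\<Sum>g\<in>H. real (if g = h then n else 0) *\<^sub>R g) = (\<Sum>g\<in>H. if g = h then r *\<^sub>R g else 0)"
    by (rule sum.cong) (auto simp: n)
  also have "\<dots> = r *\<^sub>R h" using assms by (simp add: sum.delta)
  finally show ?thesis unfolding nat_combinations_def mem_Collect_eq
    by (intro exI[of _ "\<lambda>g. if g = h then n else 0"]) simp
qed

lemma nat_combinations_sum:
  assumes "finite H" "\<And>i. i \<in> J \<Longrightarrow> f i \<in> H" "\<And>i. i \<in> J \<Longrightarrow> c i \<in> \<nat>"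
  shows "(\<Sum>i\<in>J. c i *\<^sub>R f i) \<in> nat_combinations H"
  using assms(2,3)
  by (induction J rule: infinite_finite_induct)
     (auto intro: zero_in_nat_combinations nat_combinations_add scaleR_in_nat_combinations[OF assms(1)])

lemma sum_in_closed:
  assumes "0 \<in> T" "\<And>x y. x \<in> T \<Longrightarrow> y \<in> T \<Longrightarrow> x + y \<in> T" "\<And>i. i \<in> J \<Longrightarrow> f i \<in> T"
  shows "sum f J \<in> T"
  using assms(3) by (induction J rule: infinite_finite_induct) (auto intro: assms(1,2))

section \<open>The cone spanned by the negative unit vectors and the lifted columns\<close>

definition drop_last :: "real^('n option) \<Rightarrow> real^'n::finite" where
  "drop_last z = (\<chi> i. z $ Some i)"

lemma drop_last_simps:
  "drop_last (x + y) = drop_last x + drop_last y"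
  "drop_last (r *\<^sub>R x) = r *\<^sub>R drop_last x"
  "drop_last 0 = 0"
  "drop_last (- axis (Some i) 1) = - axis i 1"
  "drop_last (append_one v) = (\<chi> i. real (v $ i))"
  "append_one v $ None = 1"
  by (simp_all add: drop_last_def vec_eq_iff append_one_def axis_def)

context
  fixes B :: "nat^'q::finite^'n::finite" and H :: "(real^('n option)) set"
  defines "H \<equiv> range (\<lambda>i. - axis (Some i) 1) \<union> range (\<lambda>j. append_one (column j B))"
begin

lemma finite_generators: "finite H"
  unfolding H_def by simp

lemma generators_int_lattice: "H \<subseteq> int_lattice"
  unfolding H_def int_lattice_def append_one_def axis_def by (auto split: option.splits)

text \<open>The slack of \<open>drop_last z \<le> B y\<close> gives the coefficients of the vectors
  -e_i, and \<open>y\<close> those of the lifted columns. The same identity serves real and natural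
  coefficients.\<close>

lemma generators_representation:
  "z = (\<Sum>i\<in>UNIV. (real_matrix B *v y - drop_last z) $ i *\<^sub>R (- axis (Some i) 1))
     + (\<Sum>j\<in>UNIV. y $ j *\<^sub>R append_one (column j B))"
  if "z $ None = y \<bullet> 1" for z :: "real^('n option)"
proof -
  have *: "(\<Sum>i\<in>UNIV. c $ i *\<^sub>R (- axis (Some i) 1) :: real^('n option)) $ Some k = - c $ k"
    for c :: "real^'n" and k
  proof -
    have "(c $ i *\<^sub>R (- axis (Some i) 1) :: real^('n option)) $ Some k = (if i = k then - c $ i else 0)" for i
      by (simp add: axis_def)
    then show ?thesis by (simp only: sum_component) (simp add: sum.delta)
  qed
  show ?thesis
    unfolding vec_eq_iff
  proof
    fix k show "z $ k = ((\<Sum>i\<in>UNIV. (real_matrix B *v y - drop_last z) $ i *\<^sub>R (- axis (Some i) 1))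
     + (\<Sum>j\<in>UNIV. y $ j *\<^sub>R append_one (column j B))) $ k"
    proof (cases k)
      case None
      then show ?thesis using that by (simp add: inner_one append_one_def axis_def)
    next
      case (Some i)
      show ?thesis unfolding Some vector_add_component *
        by (simp add: append_one_def drop_last_def matrix_vector_mult_def real_matrix_def column_def mult.commute)
    qed
  qed
qed

text \<open>The generators -e_i relax the equation between \<open>B y\<close> and the first n
  coordinates to an inequality; the lifted columns record the coordinate sum of \<open>y\<close> in
  the last one.\<close>

lemma real_cone_generators:
  "real_cone H = {z. real_feasible (- real_matrix B) (- drop_last z) (z $ None)}" (is "_ = ?T")
proof
  have add: "x + y \<in> ?T" if "x \<in> ?T" "y \<in> ?T" for x y
  proof -
    obtain u v where "0 \<le> u" "u \<bullet> 1 = x $ None" "drop_last x \<le> real_matrix B *v u"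
      "0 \<le> v" "v \<bullet> 1 = y $ None" "drop_last y \<le> real_matrix B *v v"
      using \<open>x \<in> ?T\<close> \<open>y \<in> ?T\<close> by (auto simp: real_feasible_uminus)
    then show ?thesis unfolding mem_Collect_eq real_feasible_uminus
      by (intro exI[of _ "u + v"])
        (auto simp: inner_add_left drop_last_simps matrix_vector_right_distrib intro: add_mono)
  qed
  have scale: "r *\<^sub>R x \<in> ?T" if "x \<in> ?T" "0 \<le> r" for x r
  proof -
    obtain u where "0 \<le> u" "u \<bullet> 1 = x $ None" "drop_last x \<le> real_matrix B *v u"
      using \<open>x \<in> ?T\<close> by (auto simp: real_feasible_uminus)
    then show ?thesis unfolding mem_Collect_eq real_feasible_uminus using \<open>0 \<le> r\<close>
      by (intro exI[of _ "r *\<^sub>R u"])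
        (auto simp: drop_last_simps matrix_vector_mult_scaleR less_eq_vec_def intro: mult_left_mono)
  qed
  have zero: "0 \<in> ?T"
    unfolding mem_Collect_eq real_feasible_uminus
    by (intro exI[of _ 0]) (simp add: drop_last_simps)
  have gen: "h \<in> ?T" if "h \<in> H" for h
  proof -
    consider i where "h = - axis (Some i) 1" | j where "h = append_one (column j B)"
      using \<open>h \<in> H\<close> unfolding H_def by blast
    then show ?thesis
    proof cases
      case 1 then show ?thesis
        unfolding mem_Collect_eq real_feasible_uminus
        by (intro exI[of _ 0]) (simp add: drop_last_simps, simp add: axis_def less_eq_vec_def)
    next
      case 2
      have "column j (real_matrix B) = (\<chi> i. real (column j B $ i))"
        by (simp add: vec_eq_iff column_def real_matrix_def)
      with 2 show ?thesis
        unfolding mem_Collect_eq real_feasible_uminus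
        using nat_vectors_iff axis_in_nat_vectors
        by (intro exI[of _ "axis j 1"]) (simp add: matrix_vector_mult_axis drop_last_simps axis_inner_one)
    qed
  qed
  show "real_cone H \<subseteq> ?T"
  proof
    fix z assume "z \<in> real_cone H"
    then obtain c where c: "z = (\<Sum>h\<in>H. c h *\<^sub>R h)" "\<forall>h\<in>H. 0 \<le> c h"
      unfolding real_cone_def by blast
    show "z \<in> ?T" unfolding c(1)
      by (rule sum_in_closed[of ?T, OF zero add]) (use c(2) gen scale in auto)
  qed
  show "?T \<subseteq> real_cone H"
  proof
    fix z assume "z \<in> ?T"
    then obtain y where y: "0 \<le> y" "z $ None = y \<bullet> 1" "drop_last z \<le> real_matrix B *v y"
      by (auto simp: real_feasible_uminus)
    show "z \<in> real_cone H"
      by (subst generators_representation[OF y(2)], intro real_cone_add real_cone_sum finite_generators)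
        (use y(1,3) in \<open>auto simp: H_def less_eq_vec_def\<close>)
  qed
qed

lemma nat_combinations_generators:
  "nat_combinations H
   = {z \<in> int_lattice. nat_feasible (- real_matrix B) (- drop_last z) (z $ None)}" (is "_ = ?T")
proof
  have add: "x + y \<in> ?T" if "x \<in> ?T" "y \<in> ?T" for x y
  proof -
    obtain u v where "u \<in> nat_vectors" "u \<bullet> 1 = x $ None" "drop_last x \<le> real_matrix B *v u"
      "v \<in> nat_vectors" "v \<bullet> 1 = y $ None" "drop_last y \<le> real_matrix B *v v"
      using \<open>x \<in> ?T\<close> \<open>y \<in> ?T\<close> by (auto simp: nat_feasible_uminus)
    then show ?thesis using \<open>x \<in> ?T\<close> \<open>y \<in> ?T\<close> unfolding mem_Collect_eq nat_feasible_uminus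
      by (intro conjI bexI[of _ "u + v"])
        (auto simp: inner_add_left drop_last_simps matrix_vector_right_distrib nat_vectors_add
          int_lattice_def intro: add_mono)
  qed
  have zero: "0 \<in> ?T"
    unfolding mem_Collect_eq nat_feasible_uminus
    by (intro conjI bexI[of _ 0] zero_in_nat_vectors) (simp_all add: drop_last_simps int_lattice_def)
  have scale: "real n *\<^sub>R x \<in> ?T" if "x \<in> ?T" for x n
  proof (induction n)
    case 0 show ?case using zero by simp
  next
    case (Suc n) show ?case using add[OF \<open>x \<in> ?T\<close> Suc] by (simp add: scaleR_left_distrib)
  qed
  have gen: "h \<in> ?T" if "h \<in> H" for h
  proof -
    consider i where "h = - axis (Some i) 1" | j where "h = append_one (column j B)"
      using \<open>h \<in> H\<close> unfolding H_def by blast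
    then have "nat_feasible (- real_matrix B) (- drop_last h) (h $ None)"
    proof cases
      case 1 then show ?thesis
        unfolding nat_feasible_uminus
        by (intro bexI[of _ 0] zero_in_nat_vectors)
          (simp add: drop_last_simps, simp add: axis_def less_eq_vec_def)
    next
      case 2
      have "column j (real_matrix B) = (\<chi> i. real (column j B $ i))"
        by (simp add: vec_eq_iff column_def real_matrix_def)
      with 2 show ?thesis
        unfolding nat_feasible_uminus
        by (intro bexI[of _ "axis j 1"])
          (simp_all add: matrix_vector_mult_axis drop_last_simps axis_inner_one axis_in_nat_vectors)
    qed
    with generators_int_lattice that show ?thesis by blast
  qed
  show "nat_combinations H \<subseteq> ?T"
  proof
    fix z assume "z \<in> nat_combinations H"
    then obtain c where c: "z = (\<Sum>h\<in>H. real (c h) *\<^sub>R h)"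
      unfolding nat_combinations_def by auto
    show "z \<in> ?T" unfolding c
      by (rule sum_in_closed[of ?T, OF zero add]) (use gen scale in auto)
  qed
  show "?T \<subseteq> nat_combinations H"
  proof
    fix z assume z: "z \<in> ?T"
    then obtain y where y: "y \<in> nat_vectors" "z $ None = y \<bullet> 1" "drop_last z \<le> real_matrix B *v y"
      by (auto simp: nat_feasible_uminus)
    have "real_matrix B *v y \<in> int_lattice"
      using y(1) by (intro int_lattice_matrix_vector_mult) (auto simp: nat_vectors_iff real_matrix_def)
    \<comment> \<open>Integrality of \<open>z\<close> and of the matrix makes the slack a natural
      vector, hence an admissible family of coefficients.\<close>
    then have "(real_matrix B *v y - drop_last z) $ i \<in> \<nat>" for i
      using y(3) z unfolding Nats_altdef2 by (simp add: int_lattice_def drop_last_def less_eq_vec_def)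
    with y(1) show "z \<in> nat_combinations H"
      by (subst generators_representation[OF y(2)], intro nat_combinations_add nat_combinations_sum finite_generators)
        (auto simp: H_def nat_vectors_def)
  qed
qed

text \<open>Natural combinations always lie in the cone and in the lattice, so only the reverse
  inclusion has content, and the two descriptions of the hulls turn it into a statement about
  feasibility.\<close>

lemma hilbert_basis_iff_decomposable:
  "hilbert_basis H \<longleftrightarrow> decomposable (- real_matrix B)"
proof -
  let ?L = "- real_matrix B"
  have "hilbert_basis H \<longleftrightarrow>
    (\<forall>z\<in>int_lattice. real_feasible ?L (- drop_last z) (z $ None) \<longrightarrow> nat_feasible ?L (- drop_last z) (z $ None))"
    unfolding hilbert_basis_def real_cone_generators nat_combinations_generators
    using finite_generators generators_int_lattice
    by (auto simp: real_feasible_def nat_feasible_def nat_vectors_iff)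
  also have "\<dots> \<longleftrightarrow> decomposable ?L"
    unfolding decomposable_uminus
  proof safe
    fix z :: "real^('n option)"
    assume dec: "\<forall>a\<in>int_lattice. \<forall>b. real_feasible ?L (- a) (real b) \<longrightarrow> nat_feasible ?L (- a) (real b)"
    assume z: "z \<in> int_lattice" and f: "real_feasible ?L (- drop_last z) (z $ None)"
    \<comment> \<open>The last coordinate is integral and is the sum of a nonnegative vector, so
      restricting \<open>b\<close> to natural numbers loses nothing.\<close>
    have "z $ None \<in> \<nat>" using f z inner_one_nonneg unfolding Nats_altdef2
      by (fastforce simp: real_feasible_def int_lattice_def)
    then obtain b where "z $ None = real b" by (auto elim: Nats_cases)
    moreover have "drop_last z \<in> int_lattice" using z by (simp add: int_lattice_def drop_last_def)
    ultimately show "nat_feasible ?L (- drop_last z) (z $ None)" using dec f by simp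
  next
    fix a :: "real^'n" and b :: nat
    assume hil: "\<forall>z\<in>int_lattice. real_feasible ?L (- drop_last z) (z $ None) \<longrightarrow> nat_feasible ?L (- drop_last z) (z $ None)"
    assume a: "a \<in> int_lattice" and f: "real_feasible ?L (- a) (real b)"
    define z :: "real^('n option)" where "z = (\<chi> k. case k of Some i \<Rightarrow> a $ i | None \<Rightarrow> real b)"
    have "drop_last z = a" "z $ None = real b" by (simp_all add: z_def drop_last_def)
    moreover have "z \<in> int_lattice" using a by (auto simp: z_def int_lattice_def split: option.split)
    ultimately show "nat_feasible ?L (- a) (real b)" using hil f by metis
  qed
  finally show ?thesis .
qed

end

section \<open>Leading monomials\<close>

abbreviation (input) lookup :: "('a \<Rightarrow>\<^sub>0 'b::zero) \<Rightarrow> 'a \<Rightarrow> 'b" where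
  "lookup \<equiv> Poly_Mapping.lookup"

abbreviation (input) keys :: "('a \<Rightarrow>\<^sub>0 'b::zero) \<Rightarrow> 'a set" where
  "keys \<equiv> Poly_Mapping.keys"

text \<open>The order is lexicographic, decided at the smallest index where two exponents differ.
  Listing the finitely many entries embeds it into the lexicographic order on lists of equal length.
  It makes term by term division terminate.\<close>

lemma wf_less_poly_mapping: "wf {(f, g :: 'n::{finite,linorder} \<Rightarrow>\<^sub>0 nat). f < g}"
proof -
  let ?xs = "sorted_list_of_set (UNIV :: 'n set)"
  have "(map (lookup f) ?xs, map (lookup g) ?xs) \<in> lex less_than" if "f < g" for f g :: "'n \<Rightarrow>\<^sub>0 nat"
  proof -
    from that obtain k where k: "lookup f k < lookup g k" "\<And>k'. k' < k \<Longrightarrow> lookup f k' = lookup g k'"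
      by (auto simp: less_poly_mapping.rep_eq less_fun_def)
    have "k \<in> set ?xs" by simp
    then obtain ys zs where xs: "?xs = ys @ k # zs" by (metis split_list)
    have "sorted_wrt (<) (ys @ k # zs)"
      unfolding xs[symmetric] by (rule strict_sorted_list_of_set)
    then have "\<forall>y\<in>set ys. y < k" by (simp add: sorted_wrt_append)
    then have "map (lookup f) ys = map (lookup g) ys" using k(2) by simp
    then show ?thesis unfolding xs lex_conv using k(1)
      by (auto intro!: exI[of _ "map (lookup g) ys"])
  qed
  then have "{(f, g :: 'n \<Rightarrow>\<^sub>0 nat). f < g} \<subseteq> inv_image (lex less_than) (\<lambda>f. map (lookup f) ?xs)"
    by auto
  then show ?thesis using wf_inv_image[OF wf_lex[OF wf_less_than]] wf_subset by blast
qed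

definition lead_key :: "('a::linorder \<Rightarrow>\<^sub>0 'b::zero) \<Rightarrow> 'a" where
  "lead_key f = Max (keys f)"

lemma lead_key_in_keys: "f \<noteq> 0 \<Longrightarrow> lead_key f \<in> keys f"
  unfolding lead_key_def by (rule Max_in) auto

lemma lead_key_ge: "k \<in> keys f \<Longrightarrow> k \<le> lead_key f"
  unfolding lead_key_def by (rule Max_ge) auto

lemma lead_keyI: "k \<in> keys f \<Longrightarrow> (\<And>l. l \<in> keys f \<Longrightarrow> l \<le> k) \<Longrightarrow> lead_key f = k"
  unfolding lead_key_def by (rule Max_eqI) auto

text \<open>By strict monotonicity of addition, the two leading keys are the only pair of keys with
  this sum, so a single term of the convolution survives.\<close>

lemma lookup_mult_lead_key:
  fixes f g :: "'a::{linorder,ordered_cancel_comm_monoid_add} \<Rightarrow>\<^sub>0 'b::semiring_0"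
  shows "lookup (f * g) (lead_key f + lead_key g) = lookup f (lead_key f) * lookup g (lead_key g)"
proof -
  let ?a = "lead_key f" and ?b = "lead_key g"
  have "(\<Sum>q. lookup g q when ?a + ?b = l + q) = (lookup g ?b when l = ?a)" if "lookup f l \<noteq> 0" for l
  proof (cases "l = ?a")
    case True then show ?thesis by simp
  next
    case False
    with lead_key_ge[of l f] that have "l < ?a" by (simp add: in_keys_iff)
    have "(lookup g q when ?a + ?b = l + q) = 0" for q
    proof (cases "lookup g q = 0")
      case True then show ?thesis by simp
    next
      case nz: False
      then have "q \<le> ?b" using lead_key_ge[of q g] by (simp add: in_keys_iff)
      with \<open>l < ?a\<close> have "l + q < ?a + ?b" by (rule add_less_le_mono)
      then show ?thesis by simp
    qed
    with False show ?thesis by simp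
  qed
  then have "lookup f l * (\<Sum>q. lookup g q when ?a + ?b = l + q) = (lookup f ?a * lookup g ?b when l = ?a)" for l
    by (cases "lookup f l = 0") (auto simp: when_def)
  then show ?thesis by (simp add: lookup_mult)
qed

lemma lead_key_mult:
  fixes f g :: "'a::{linorder,ordered_cancel_comm_monoid_add} \<Rightarrow>\<^sub>0 'b::semiring_no_zero_divisors"
  assumes "f \<noteq> 0" "g \<noteq> 0"
  shows "lead_key (f * g) = lead_key f + lead_key g"
proof (rule lead_keyI)
  show "lead_key f + lead_key g \<in> keys (f * g)"
    using lead_key_in_keys[OF assms(1)] lead_key_in_keys[OF assms(2)]
    by (simp add: in_keys_iff lookup_mult_lead_key)
  fix l assume "l \<in> keys (f * g)"
  then obtain a b where "a \<in> keys f" "b \<in> keys g" "l = a + b"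
    using keys_mult[of f g] by blast
  then show "l \<le> lead_key f + lead_key g" by (simp add: add_mono lead_key_ge)
qed

text \<open>The term order compares degrees in t first and exponents second. The pair stores the
  degree last, which is why comparisons go through \<open>prod.swap\<close>.\<close>

definition lead_monomial :: "('a::linorder \<Rightarrow>\<^sub>0 'b::zero) poly \<Rightarrow> 'a \<times> nat" where
  "lead_monomial p = (lead_key (lead_coeff p), degree p)"

definition lead_scalar :: "('a::linorder \<Rightarrow>\<^sub>0 'b::zero) poly \<Rightarrow> 'b" where
  "lead_scalar p = lookup (lead_coeff p) (lead_key (lead_coeff p))"

definition monomial :: "'b::zero \<Rightarrow> 'a \<times> nat \<Rightarrow> ('a \<Rightarrow>\<^sub>0 'b) poly" where
  "monomial c m = monom (Poly_Mapping.single (fst m) c) (snd m)"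

definition exponents :: "('a \<Rightarrow>\<^sub>0 'b::zero) poly \<Rightarrow> ('a \<times> nat) set" where
  "exponents p = {(a, k). lookup (coeff p k) a \<noteq> 0}"

lemma lead_monomial_in_exponents: "p \<noteq> 0 \<Longrightarrow> lead_monomial p \<in> exponents p"
  using lead_key_in_keys[of "lead_coeff p"]
  by (simp add: lead_monomial_def exponents_def in_keys_iff)

lemma lead_scalar_nonzero: "p \<noteq> 0 \<Longrightarrow> lead_scalar p \<noteq> 0"
  using lead_key_in_keys[of "lead_coeff p"] by (simp add: lead_scalar_def in_keys_iff)

context
  fixes p q :: "('a::{linorder,ordered_cancel_comm_monoid_add} \<Rightarrow>\<^sub>0 'b::idom) poly"
  assumes nonzero: "p \<noteq> 0" "q \<noteq> 0"
begin

lemma lead_monomial_mult: "lead_monomial (p * q) = lead_monomial p + lead_monomial q"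
  using nonzero
  by (simp add: lead_monomial_def lead_coeff_mult lead_key_mult del: coeff_degree_mult) (simp add: degree_mult_eq)

lemma lead_scalar_mult: "lead_scalar (p * q) = lead_scalar p * lead_scalar q"
  using nonzero
  by (simp add: lead_scalar_def lead_coeff_mult lead_key_mult lookup_mult_lead_key del: coeff_degree_mult)

text \<open>Cancelling equal leading terms either lowers the degree in t or removes the leading key
  from the top coefficient, whose remaining keys are smaller.\<close>

lemma lead_monomial_diff:
  assumes same: "lead_monomial p = lead_monomial q" "lead_scalar p = lead_scalar q" and "p \<noteq> q"
  shows "(prod.swap (lead_monomial (p - q)), prod.swap (lead_monomial p)) \<in> less_than <*lex*> {(f, g). f < g}"
proof -
  have deg: "degree q = degree p" using same(1) by (simp add: lead_monomial_def)
  show ?thesis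
  proof (cases "degree (p - q) < degree p")
    case True then show ?thesis by (simp add: lead_monomial_def)
  next
    case False
    then have d: "degree (p - q) = degree p"
      using degree_diff_le_max[of p q] deg by simp
    let ?r = "lead_coeff (p - q)"
    have r: "?r = lead_coeff p - lead_coeff q" by (simp add: d deg)
    have "?r \<noteq> 0" using \<open>p \<noteq> q\<close> by (simp only: leading_coeff_0_iff) simp
    then have k: "lead_key ?r \<in> keys ?r" by (rule lead_key_in_keys)
    have lk: "lead_key (lead_coeff q) = lead_key (lead_coeff p)"
      using same(1)[unfolded lead_monomial_def prod.inject] by (elim conjE) (rule sym)
    have "lookup ?r (lead_key (lead_coeff p)) = 0"
      using same(2) lk unfolding r by (simp add: lead_scalar_def lookup_minus)
    then have "lead_key ?r \<noteq> lead_key (lead_coeff p)" using k by (auto simp: in_keys_iff)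
    moreover have "lead_key ?r \<in> keys (lead_coeff p) \<union> keys (lead_coeff q)"
      using k unfolding r by (auto simp: in_keys_iff lookup_minus)
    then have "lead_key ?r \<le> lead_key (lead_coeff p)"
      using lead_key_ge[of "lead_key ?r" "lead_coeff p"] lead_key_ge[of "lead_key ?r" "lead_coeff q"] lk by auto
    ultimately show ?thesis by (simp add: lead_monomial_def d)
  qed
qed

end

lemma lead_monomial_power:
  fixes p :: "('a::{linorder,ordered_cancel_comm_monoid_add} \<Rightarrow>\<^sub>0 'b::idom) poly"
  assumes "p \<noteq> 0"
  shows "lead_monomial (p ^ k) = (\<Sum>i<k. lead_monomial p)"
proof (induction k)
  case 0
  have "lead_key (1 :: 'a \<Rightarrow>\<^sub>0 'b) = 0" by (simp add: lead_key_def)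
  then show ?case by (simp add: lead_monomial_def zero_prod_def)
next
  case (Suc k) with assms show ?case by (simp add: lead_monomial_mult add.commute)
qed

section \<open>Single monomials and supports of polynomials\<close>

lemma single_eq_0_iff: "Poly_Mapping.single a c = 0 \<longleftrightarrow> c = 0"
  by (metis lookup_single_eq lookup_zero single_zero)

lemma monomial_eq_0_iff: "monomial c m = 0 \<longleftrightarrow> c = 0"
  by (simp add: monomial_def single_eq_0_iff)

lemma coeff_monomial: "coeff (monomial c m) k = (if k = snd m then Poly_Mapping.single (fst m) c else 0)"
  by (simp add: monomial_def)

lemma lead_monomial_monomial: "c \<noteq> 0 \<Longrightarrow> lead_monomial (monomial c m) = m"
  by (cases m) (simp add: lead_monomial_def monomial_def degree_monom_eq lead_key_def single_eq_0_iff)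

lemma lead_scalar_monomial: "c \<noteq> 0 \<Longrightarrow> lead_scalar (monomial c m) = c"
  by (simp add: lead_scalar_def monomial_def degree_monom_eq lead_key_def single_eq_0_iff)

lemma monomial_mult: "monomial c m * monomial d n = monomial (c * d) (m + n)"
  by (simp add: monomial_def mult_monom mult_single)

lemma monomial_one: "monomial 1 0 = 1"
  by (simp add: monomial_def zero_prod_def monom_0 one_pCons)

lemma monomial_power: "monomial (1::'b::comm_semiring_1) m ^ k = monomial 1 (\<Sum>i<k. m)"
  by (induction k) (simp_all add: monomial_one monomial_mult add.commute)

lemma exponents_monomial: "exponents (monomial c m) = (if c = 0 then {} else {m})"
  by (auto simp: exponents_def coeff_monomial lookup_single when_def split: if_splits)

lemma finite_exponents: "finite (exponents p)"
proof -
  have "exponents p \<subseteq> (\<Union>k\<le>degree p. keys (coeff p k) \<times> {k})"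
    by (auto simp: exponents_def in_keys_iff) (metis coeff_eq_0 lookup_zero not_le)
  then show ?thesis by (rule finite_subset) auto
qed

lemma sum_monomials:
  "p = (\<Sum>(a, k)\<in>exponents p. monomial (lookup (coeff p k) a) (a, k))" (is "_ = ?q")
proof (intro poly_eqI poly_mapping_eqI)
  fix l b
  have "lookup (coeff ?q l) b = (\<Sum>(a, k)\<in>exponents p. if (a, k) = (b, l) then lookup (coeff p l) b else 0)"
    unfolding coeff_sum lookup_sum
    by (rule sum.cong) (auto simp: coeff_monomial lookup_single)
  also have "\<dots> = (\<Sum>m\<in>exponents p. if m = (b, l) then lookup (coeff p l) b else 0)"
    by (rule sum.cong) (auto split: if_splits)
  also have "\<dots> = lookup (coeff p l) b"
    by (simp add: finite_exponents) (simp add: exponents_def)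
  finally show "lookup (coeff p l) b = lookup (coeff ?q l) b" by simp
qed

section \<open>Normality of monomial algebras\<close>

definition is_subring :: "'a::comm_ring_1 set \<Rightarrow> bool" where
  "is_subring S \<longleftrightarrow> 1 \<in> S \<and> (\<forall>a\<in>S. - a \<in> S) \<and> (\<forall>a\<in>S. \<forall>b\<in>S. a + b \<in> S \<and> a * b \<in> S)"

context
  fixes S :: "'a::comm_ring_1 set"
  assumes S: "is_subring S"
begin

lemma is_subringD:
  "1 \<in> S" "a \<in> S \<Longrightarrow> - a \<in> S" "a \<in> S \<Longrightarrow> b \<in> S \<Longrightarrow> a + b \<in> S" "a \<in> S \<Longrightarrow> b \<in> S \<Longrightarrow> a * b \<in> S"
  using S by (auto simp: is_subring_def)

lemma is_subring_diff: "a \<in> S \<Longrightarrow> b \<in> S \<Longrightarrow> a - b \<in> S"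
  using is_subringD(3)[of a "- b"] is_subringD(2) by simp

lemma is_subring_zero: "0 \<in> S"
  using is_subring_diff[OF is_subringD(1) is_subringD(1)] by simp

lemma is_subring_power: "a \<in> S \<Longrightarrow> a ^ k \<in> S"
  by (induction k) (auto intro: is_subringD)

lemma is_subring_sum: "(\<And>i. i \<in> J \<Longrightarrow> f i \<in> S) \<Longrightarrow> sum f J \<in> S"
  by (induction J rule: infinite_finite_induct) (auto intro: is_subringD is_subring_zero)

lemma is_subring_of_nat: "of_nat k \<in> S"
  by (induction k) (auto intro: is_subringD is_subring_zero)

end

lemma to_fract_power: "to_fract (a ^ k) = to_fract a ^ k"
  by (induction k) simp_all

lemma is_subring_to_fract:
  assumes "is_subring S"
  shows "is_subring (to_fract ` S)"
  unfolding is_subring_def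
proof safe
  show "1 \<in> to_fract ` S" using is_subringD(1)[OF assms] by (metis image_eqI to_fract_1)
next
  fix a assume "a \<in> S" then show "- to_fract a \<in> to_fract ` S"
    using is_subringD(2)[OF assms] by (metis image_eqI to_fract_uminus)
next
  fix a b assume "a \<in> S" "b \<in> S"
  then show "to_fract a + to_fract b \<in> to_fract ` S" "to_fract a * to_fract b \<in> to_fract ` S"
    using is_subringD(3,4)[OF assms] by (metis image_eqI to_fract_add, metis image_eqI to_fract_mult)
qed

text \<open>With d the degree of the integral equation, \<open>g ^ d\<close> clears the denominators
  of all powers below d, and the equation reduces every higher power to smaller ones with
  coefficients in the ring.\<close>

lemma integral_imp_common_denominator:
  fixes S :: "'a::idom set"
  assumes S: "is_subring S" and f: "f \<in> S" and g: "g \<in> S" "g \<noteq> 0"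
    and int: "integral_over (to_fract ` S) (Fract f g)"
  obtains c where "c \<in> S" "c \<noteq> 0" "\<And>k. to_fract c * Fract f g ^ k \<in> to_fract ` S"
proof -
  let ?z = "Fract f g" and ?T = "to_fract ` S"
  note T = is_subring_to_fract[OF S]
  obtain p where p: "lead_coeff p = 1" "\<And>i. coeff p i \<in> ?T" "poly p ?z = 0"
    using int unfolding integral_over_def by blast
  let ?d = "degree p"
  have gz: "to_fract g * ?z = to_fract f" using g(2) by (simp add: to_fract_def eq_fract)
  have "to_fract (g ^ ?d) * ?z ^ k \<in> ?T" for k
  proof (induction k rule: less_induct)
    case (less k)
    show ?case
    proof (cases "k < ?d")
      case True
      have "to_fract (g ^ ?d) * ?z ^ k = to_fract g ^ (?d - k) * (to_fract g * ?z) ^ k"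
        using True by (simp add: power_mult_distrib to_fract_power flip: power_add mult.assoc)
      also have "\<dots> = to_fract (g ^ (?d - k) * f ^ k)"
        unfolding gz by (simp add: to_fract_power to_fract_mult)
      finally show ?thesis
        using is_subringD(4)[OF S is_subring_power[OF S g(1)] is_subring_power[OF S f]] by (simp only: image_eqI)
    next
      case False
      \<comment> \<open>Multiplying the equation by \<open>?z ^ (k - ?d)\<close> expresses
        \<open>?z ^ k\<close> through the exponents \<open>k - ?d + i\<close> with
        \<open>i < ?d\<close>, all below \<open>k\<close>.\<close>
      have "0 = ?z ^ (k - ?d) * (\<Sum>i\<le>?d. coeff p i * ?z ^ i)" using p(3) by (simp add: poly_altdef)
      also have "\<dots> = ?z ^ (k - ?d) * ?z ^ ?d + ?z ^ (k - ?d) * (\<Sum>i<?d. coeff p i * ?z ^ i)"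
        using p(1) by (simp add: lessThan_Suc_atMost[symmetric] algebra_simps)
      also have "?z ^ (k - ?d) * ?z ^ ?d = ?z ^ k" using False by (simp flip: power_add)
      finally have "?z ^ k = - (\<Sum>i<?d. coeff p i * (?z ^ (k - ?d + i)))"
        by (simp add: eq_neg_iff_add_eq_0 sum_distrib_left power_add mult_ac)
      then have "to_fract (g ^ ?d) * ?z ^ k
          = - (\<Sum>i<?d. coeff p i * (to_fract (g ^ ?d) * ?z ^ (k - ?d + i)))"
        by (simp add: sum_distrib_left mult_ac)
      also have "\<dots> \<in> ?T"
        using False
        by (intro is_subringD(2)[OF T] is_subring_sum[OF T] is_subringD(4)[OF T p(2)] less) auto
      finally show ?thesis .
    qed
  qed
  then show ?thesis using that[of "g ^ ?d"] g is_subring_power[OF S g(1)] by simp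
qed

section \<open>Algebras spanned by monomials\<close>

definition monomial_algebra :: "('a \<times> nat) set \<Rightarrow> ('a \<Rightarrow>\<^sub>0 'b::zero) poly set" where
  "monomial_algebra M = {p. exponents p \<subseteq> M}"

text \<open>The monoid is completely integrally closed: if c + k (a - b) lies in \<open>M\<close>
  for all k, so does a - b. Differences are written additively because exponents are natural, and
  the sums over \<open>i<k\<close> are k-fold multiples.\<close>

definition completely_saturated :: "('a::comm_monoid_add \<times> nat) set \<Rightarrow> bool" where
  "completely_saturated M \<longleftrightarrow> (\<forall>c\<in>M. \<forall>a\<in>M. \<forall>b\<in>M.
     (\<forall>k. \<exists>h\<in>M. c + (\<Sum>i<k::nat. a) = h + (\<Sum>i<k. b)) \<longrightarrow> (\<exists>m\<in>M. a = m + b))"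

context
  fixes M :: "(('n::{finite,linorder} \<Rightarrow>\<^sub>0 nat) \<times> nat) set"
  assumes M0: "0 \<in> M" and M_add: "\<And>a b. a \<in> M \<Longrightarrow> b \<in> M \<Longrightarrow> a + b \<in> M"
begin

lemma is_subring_monomial_algebra:
  "is_subring (monomial_algebra M :: ('n, 'k::field) mpoly_ring poly set)"
  unfolding is_subring_def monomial_algebra_def mem_Collect_eq
proof (intro conjI ballI)
  show "exponents (1 :: ('n, 'k) mpoly_ring poly) \<subseteq> M"
    using M0 by (simp add: exponents_monomial flip: monomial_one)
next
  fix p :: "('n, 'k) mpoly_ring poly" assume p: "p \<in> {p. exponents p \<subseteq> M}"
  then show "exponents (- p) \<subseteq> M" by (auto simp: exponents_def)
  fix q :: "('n, 'k) mpoly_ring poly" assume q: "q \<in> {p. exponents p \<subseteq> M}"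
  show "exponents (p + q) \<subseteq> M"
    using p q by (fastforce simp: exponents_def lookup_add)
  show "exponents (p * q) \<subseteq> M"
  proof
    fix m assume "m \<in> exponents (p * q)"
    then obtain a k where m: "m = (a, k)" "lookup (coeff (p * q) k) a \<noteq> 0"
      by (auto simp: exponents_def)
    then obtain i where i: "i \<le> k" "lookup (coeff p i * coeff q (k - i)) a \<noteq> 0"
      unfolding coeff_mult lookup_sum by (meson atMost_iff sum.neutral)
    then obtain b d where "b \<in> keys (coeff p i)" "d \<in> keys (coeff q (k - i))" "a = b + d"
      using keys_mult[of "coeff p i" "coeff q (k - i)"] by (auto simp: in_keys_iff)
    then have "(b, i) \<in> M" "(d, k - i) \<in> M" using p q by (auto simp: exponents_def in_keys_iff)
    from M_add[OF this] show "m \<in> M" using m(1) i(1) \<open>a = b + d\<close> by simp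
  qed
qed

text \<open>
  Comparing the leading monomials in
  \<open>c f\<^sup>k = h\<^sub>k g\<^sup>k\<close> for all \<open>k\<close> shows that the leading monomial of \<open>f\<close> is a multiple of that of
  \<open>g\<close>, and removing the corresponding term from \<open>f / g\<close> preserves the assumption.
\<close>

lemma completely_saturated_imp_dvd:
  fixes f g c :: "('n, 'k::field) mpoly_ring poly"
  assumes sat: "completely_saturated M"
    and g: "g \<in> monomial_algebra M" "g \<noteq> 0" and c: "c \<in> monomial_algebra M" "c \<noteq> 0"
    and f: "f \<in> monomial_algebra M" "\<And>k. \<exists>h\<in>monomial_algebra M. c * f ^ k = h * g ^ k"
  shows "\<exists>h\<in>monomial_algebra M. f = h * g"
  using f
proof (induction "prod.swap (lead_monomial f)" arbitrary: f
    rule: wf_induct_rule[OF wf_lex_prod[OF wf_less_than wf_less_poly_mapping]])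
  case (1 f)
  let ?S = "monomial_algebra M :: ('n, 'k) mpoly_ring poly set"
  note S = is_subring_monomial_algebra[where 'k = 'k]
  have lm: "p \<in> ?S \<Longrightarrow> p \<noteq> 0 \<Longrightarrow> lead_monomial p \<in> M" for p
    using lead_monomial_in_exponents[of p] unfolding monomial_algebra_def by blast
  show ?case
  proof (cases "f = 0")
    case True
    then show ?thesis using is_subring_zero[OF S] by (intro bexI[of _ 0]) auto
  next
    case False
    have "\<exists>h\<in>M. lead_monomial c + (\<Sum>i<k. lead_monomial f) = h + (\<Sum>i<k. lead_monomial g)" for k :: nat
    proof -
      obtain h where h: "h \<in> ?S" "c * f ^ k = h * g ^ k" using 1(3) by blast
      with False c(2) have "h \<noteq> 0" by auto
      have "lead_monomial (c * f ^ k) = lead_monomial c + (\<Sum>i<k. lead_monomial f)"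
        using False c(2) by (simp add: lead_monomial_mult lead_monomial_power)
      moreover have "lead_monomial (h * g ^ k) = lead_monomial h + (\<Sum>i<k. lead_monomial g)"
        using \<open>h \<noteq> 0\<close> g(2) by (simp add: lead_monomial_mult lead_monomial_power)
      ultimately show ?thesis using h lm[OF h(1) \<open>h \<noteq> 0\<close>] by metis
    qed
    with sat lm[OF c] lm[OF g] lm[OF 1(2) False]
    obtain m where m: "m \<in> M" "lead_monomial f = m + lead_monomial g"
      unfolding completely_saturated_def by blast
    define t where "t = monomial (lead_scalar f / lead_scalar g) m"
    have quot: "lead_scalar f / lead_scalar g \<noteq> 0"
      using False g(2) by (simp add: lead_scalar_nonzero)
    then have t: "t \<noteq> 0" by (simp add: t_def monomial_eq_0_iff)
    have tS: "t \<in> ?S" using m(1) by (simp add: t_def monomial_algebra_def exponents_monomial)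
    have tg: "lead_monomial (t * g) = lead_monomial f" "lead_scalar (t * g) = lead_scalar f" "t * g \<noteq> 0"
      using t g(2) m(2) quot lead_scalar_nonzero[OF g(2)]
      by (simp_all add: lead_monomial_mult lead_scalar_mult)
        (simp_all add: t_def lead_monomial_monomial lead_scalar_monomial)
    show ?thesis
    proof (cases "f = t * g")
      case True with tS show ?thesis by blast
    next
      case neq: False
      have "\<exists>h\<in>?S. f - t * g = h * g"
      proof (rule 1(1))
        show "(prod.swap (lead_monomial (f - t * g)), prod.swap (lead_monomial f))
            \<in> less_than <*lex*> {(f, g). f < g}"
          using lead_monomial_diff[OF False tg(3)] tg(1,2) neq by simp
        show "f - t * g \<in> ?S"
          using 1(2) tS g(1) by (intro is_subring_diff[OF S] is_subringD[OF S])
        fix k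
        obtain h where h: "\<And>j. h j \<in> ?S" "\<And>j. c * f ^ j = h j * g ^ j" using 1(3) by metis
        \<comment> \<open>In the binomial expansion each \<open>c * f ^ j\<close> contributes the
          factor \<open>g ^ j\<close> and the other power contributes \<open>g ^ (k - j)\<close>, so
          \<open>g ^ k\<close> splits off with the same \<open>c\<close>.\<close>
        have "c * (f + (- t) * g) ^ k
            = (\<Sum>j\<le>k. of_nat (k choose j) * (c * f ^ j) * ((- t) * g) ^ (k - j))"
          by (subst binomial_ring) (simp add: sum_distrib_left mult_ac)
        also have "\<dots> = (\<Sum>j\<le>k. of_nat (k choose j) * h j * (- t) ^ (k - j) * (g ^ j * g ^ (k - j)))"
          unfolding h(2) power_mult_distrib by (simp add: mult_ac)
        also have "\<dots> = (\<Sum>j\<le>k. of_nat (k choose j) * h j * (- t) ^ (k - j)) * g ^ k"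
          by (simp add: sum_distrib_right flip: power_add)
        finally show "\<exists>h\<in>?S. c * (f - t * g) ^ k = h * g ^ k"
          using h(1) tS
          by (intro bexI[of _ "\<Sum>j\<le>k. of_nat (k choose j) * h j * (- t) ^ (k - j)"])
            (auto intro!: is_subring_sum[OF S] is_subring_of_nat[OF S] is_subringD[OF S] is_subring_power[OF S])
      qed
      then obtain h where "h \<in> ?S" "f - t * g = h * g" by blast
      then show ?thesis using is_subringD(3)[OF S _ tS]
        by (intro bexI[of _ "h + t"]) (auto simp: algebra_simps)
    qed
  qed
qed

text \<open>An integral \<open>z = Fract f g\<close> has all \<open>c * z ^ k\<close> in the
  algebra; clearing denominators gives the divisibilities from which division of \<open>f\<close> by
  \<open>g\<close> starts.\<close>

lemma completely_saturated_imp_normal: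
  assumes "completely_saturated M"
  shows "normal_domain (monomial_algebra M :: ('n, 'k::field) mpoly_ring poly set)"
  unfolding normal_domain_def
proof (intro ballI impI)
  let ?S = "monomial_algebra M :: ('n, 'k) mpoly_ring poly set"
  note S = is_subring_monomial_algebra[where 'k = 'k]
  fix z assume "z \<in> fraction_field ?S" and int: "integral_over (to_fract ` ?S) z"
  then obtain f g where fg: "f \<in> ?S" "g \<in> ?S" "g \<noteq> 0" and z: "z = Fract f g"
    unfolding fraction_field_def by blast
  obtain c where c: "c \<in> ?S" "c \<noteq> 0" "\<And>k. to_fract c * z ^ k \<in> to_fract ` ?S"
    using integral_imp_common_denominator[OF S fg] int z by metis
  have gz: "to_fract f = z * to_fract g" using fg(3) by (simp add: z to_fract_def eq_fract)
  have "\<exists>h\<in>?S. c * f ^ k = h * g ^ k" for k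
  proof -
    obtain h where h: "h \<in> ?S" "to_fract c * z ^ k = to_fract h" using c(3) by blast
    have "to_fract (c * f ^ k) = to_fract c * z ^ k * to_fract g ^ k"
      by (simp add: to_fract_mult to_fract_power gz power_mult_distrib mult_ac)
    also have "\<dots> = to_fract (h * g ^ k)" by (simp add: h(2) to_fract_mult to_fract_power)
    finally show ?thesis using h(1) unfolding to_fract_eq_iff by blast
  qed
  from completely_saturated_imp_dvd[OF assms fg(2,3) c(1,2) fg(1) this]
  obtain h where h: "h \<in> ?S" "f = h * g" by blast
  then have "z = to_fract h" using fg(3) by (simp add: z to_fract_def eq_fract)
  with h show "z \<in> to_fract ` ?S" by blast
qed

text \<open>The monomial of \<open>m\<close> is the quotient of those of \<open>a\<close> and
  \<open>b\<close>, and its k-th power lies in the algebra. It is thus a root of T^k minus that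
  power, which is monic as \<open>k\<close> is positive.\<close>

lemma normal_imp_saturated:
  assumes normal: "normal_domain (monomial_algebra M :: ('n, 'k::field) mpoly_ring poly set)"
    and "a \<in> M" "b \<in> M" "a = m + b" and k: "k > (0::nat)" "(\<Sum>i<k. m) \<in> M"
  shows "m \<in> M"
proof -
  let ?S = "monomial_algebra M :: ('n, 'k) mpoly_ring poly set"
  note S = is_subring_monomial_algebra[where 'k = 'k]
  have mono: "monomial 1 x \<in> ?S \<longleftrightarrow> x \<in> M" for x
    by (simp add: monomial_algebra_def exponents_monomial)
  let ?x = "monomial 1 m :: ('n, 'k) mpoly_ring poly"
  let ?p = "monom (1 :: ('n, 'k) mpoly_ring poly fract) k + [:- to_fract (?x ^ k):]"
  have "to_fract ?x = Fract (monomial 1 a) (monomial 1 b)"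
    using \<open>a = m + b\<close> by (simp add: to_fract_def eq_fract monomial_mult monomial_eq_0_iff)
  then have frac: "to_fract ?x \<in> fraction_field ?S"
    unfolding fraction_field_def mem_Collect_eq using mono assms(2,3)
    by (intro exI[of _ "monomial 1 a"] exI[of _ "monomial 1 b"]) (simp add: monomial_eq_0_iff del: split_paired_All)
  have deg: "degree ?p = k"
    using k(1) by (subst degree_add_eq_left) (auto simp: degree_monom_eq)
  have "integral_over (to_fract ` ?S) (to_fract ?x)"
    unfolding integral_over_def
  proof (intro exI[of _ ?p] conjI allI)
    show "lead_coeff ?p = 1" unfolding deg using k(1) by (cases k) auto
    show "poly ?p (to_fract ?x) = 0" by (simp add: poly_monom to_fract_power)
    fix i
    have "?x ^ k \<in> ?S" using k(2) mono by (simp add: monomial_power)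
    then have *: "to_fract (?x ^ k) \<in> to_fract ` ?S" "1 \<in> to_fract ` ?S" "0 \<in> to_fract ` ?S"
      using is_subringD(1)[OF is_subring_to_fract[OF S]] is_subring_zero[OF is_subring_to_fract[OF S]] by auto
    show "coeff ?p i \<in> to_fract ` ?S"
      using * k(1) is_subringD(2)[OF is_subring_to_fract[OF S]] by (cases i) auto
  qed
  with normal frac have "to_fract ?x \<in> to_fract ` ?S" unfolding normal_domain_def by blast
  then show ?thesis unfolding image_iff to_fract_eq_iff using mono by blast
qed

end

section \<open>Monoids of feasible exponents\<close>

definition exponent_vector :: "('n::finite \<Rightarrow>\<^sub>0 nat) \<Rightarrow> real^'n" where
  "exponent_vector a = (\<chi> i. real (lookup a i))"

definition vector_exponent :: "nat^'n::finite \<Rightarrow> ('n \<Rightarrow>\<^sub>0 nat)" where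
  "vector_exponent v = Abs_poly_mapping (\<lambda>i. v $ i)"

lemma lookup_vector_exponent: "lookup (vector_exponent v) i = v $ i"
  by (simp add: vector_exponent_def)

lemma exponent_vector_nth: "exponent_vector a $ i = real (lookup a i)"
  by (simp add: exponent_vector_def)

lemma exponent_vector_add: "exponent_vector (a + b) = exponent_vector a + exponent_vector b"
  by (simp add: exponent_vector_def vec_eq_iff lookup_add)

lemma exponent_vector_zero: "exponent_vector 0 = 0"
  by (simp add: exponent_vector_def vec_eq_iff)

text \<open>
  The Rees algebra is the case \<open>s = 1\<close>, \<open>L = A\<close>, and the algebra \<open>S\<^sup>*\<close> is the case
  \<open>s = - 1\<close>, \<open>L = - A\<^sup>*\<close>.
\<close>

definition feasible_exponents :: "real \<Rightarrow> real^'q::finite^'n::finite \<Rightarrow> (('n \<Rightarrow>\<^sub>0 nat) \<times> nat) set" where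
  "feasible_exponents s L = {(a, k). nat_feasible L (s *\<^sub>R exponent_vector a) (real k)}"

lemma nat_feasible_imp_real_feasible: "nat_feasible L w b \<Longrightarrow> real_feasible L w b"
  by (auto simp: nat_feasible_def real_feasible_def nat_vectors_iff)

lemma zero_in_feasible_exponents: "0 \<in> feasible_exponents s L"
  unfolding feasible_exponents_def zero_prod_def nat_feasible_def
  by (auto simp: exponent_vector_zero intro!: bexI[OF _ zero_in_nat_vectors])

lemma feasible_exponents_add:
  assumes "a \<in> feasible_exponents s L" "b \<in> feasible_exponents s L"
  shows "a + b \<in> feasible_exponents s L"
proof -
  obtain u v where uv: "u \<in> nat_vectors" "u \<bullet> 1 = real (snd a)" "L *v u \<le> s *\<^sub>R exponent_vector (fst a)"
    "v \<in> nat_vectors" "v \<bullet> 1 = real (snd b)" "L *v v \<le> s *\<^sub>R exponent_vector (fst b)"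
    using assms by (auto simp: feasible_exponents_def nat_feasible_def)
  have "L *v (u + v) \<le> s *\<^sub>R exponent_vector (fst (a + b))"
    using add_mono[OF uv(3,6)]
    by (simp add: matrix_vector_right_distrib exponent_vector_add scaleR_right_distrib)
  moreover have "(u + v) \<bullet> 1 = real (snd (a + b))" using uv by (simp add: inner_add_left)
  ultimately show ?thesis
    using nat_vectors_add[OF uv(1,4)] unfolding feasible_exponents_def nat_feasible_def
    by (cases a, cases b) auto
qed

lemma real_feasible_nonneg: "real_feasible L w b \<Longrightarrow> 0 \<le> b"
  using inner_one_nonneg by (auto simp: real_feasible_def)

lemma fst_sum_const: "fst (\<Sum>i<k::nat. m) = (\<Sum>i<k. fst m)" and snd_sum_const: "snd (\<Sum>i<k::nat. m) = k * snd m"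
  for m :: "'a::comm_monoid_add \<times> nat"
  by (induction k) simp_all

lemma exponent_vector_sum_const: "exponent_vector (\<Sum>i<k::nat. a) = real k *\<^sub>R exponent_vector a"
  by (induction k) (simp_all add: exponent_vector_zero exponent_vector_add scaleR_left_distrib)

text \<open>Both assumptions serve the passage from normality to decomposability.
  \<open>reduce\<close> squeezes an exponent, up to the sign \<open>s\<close>, between
  \<open>L *v y\<close> and \<open>w\<close>, so that there is a monomial to speak about;
  \<open>group\<close> puts this monomial into the fraction field of the algebra.\<close>

lemma normal_iff_decomposable:
  fixes L :: "real^'q::finite^'n::{finite,linorder}"
  assumes L: "\<forall>i j. L $ i $ j \<in> \<int>" and s: "s \<in> \<int>"
    and reduce: "\<And>w y. w \<in> int_lattice \<Longrightarrow> 0 \<le> y \<Longrightarrow> L *v y \<le> w \<Longrightarrow>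
      \<exists>a. s *\<^sub>R exponent_vector a \<le> w \<and> L *v y \<le> s *\<^sub>R exponent_vector a"
    and group: "\<And>a k. real_feasible L (s *\<^sub>R exponent_vector a) (real k) \<Longrightarrow>
      \<exists>p\<in>feasible_exponents s L. \<exists>q\<in>feasible_exponents s L. p = (a, k) + q"
  shows "normal_domain (monomial_algebra (feasible_exponents s L) :: ('n, 'k::field) mpoly_ring poly set)
    \<longleftrightarrow> decomposable L"
proof
  let ?M = "feasible_exponents s L"
  assume dec: "decomposable L"
  have "completely_saturated ?M"
    unfolding completely_saturated_def
  proof (intro ballI impI)
    fix c a b
    assume "c \<in> ?M" "a \<in> ?M" "b \<in> ?M"
      and ex: "\<forall>k. \<exists>h\<in>?M. c + (\<Sum>i<k::nat. a) = h + (\<Sum>i<k. b)"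
    define w where "w = s *\<^sub>R (exponent_vector (fst a) - exponent_vector (fst b))"
    have eqs: "\<exists>h\<in>?M. exponent_vector (fst c) + real k *\<^sub>R exponent_vector (fst a)
          = exponent_vector (fst h) + real k *\<^sub>R exponent_vector (fst b)
        \<and> snd c + k * snd a = snd h + k * snd b" for k
    proof -
      obtain h where h: "h \<in> ?M" "c + (\<Sum>i<k. a) = h + (\<Sum>i<k. b)" using ex by blast
      from arg_cong[OF h(2), of "\<lambda>x. exponent_vector (fst x)"] arg_cong[OF h(2), of snd]
      show ?thesis using h(1)
        by (intro bexI[of _ h])
          (simp_all add: fst_sum_const snd_sum_const exponent_vector_add exponent_vector_sum_const)
    qed
    have lim: "real_feasible L (s *\<^sub>R exponent_vector (fst c) + real k *\<^sub>R w)
        (real (snd c) + real k * (real (snd a) - real (snd b)))" for k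
    proof -
      obtain h where h: "h \<in> ?M" "exponent_vector (fst c) + real k *\<^sub>R exponent_vector (fst a)
          = exponent_vector (fst h) + real k *\<^sub>R exponent_vector (fst b)"
        "snd c + k * snd a = snd h + k * snd b"
        using eqs by blast
      have "s *\<^sub>R exponent_vector (fst c) + real k *\<^sub>R w
          = s *\<^sub>R (exponent_vector (fst c) + real k *\<^sub>R exponent_vector (fst a)
            - real k *\<^sub>R exponent_vector (fst b))"
        by (simp add: w_def algebra_simps)
      also have "\<dots> = s *\<^sub>R exponent_vector (fst h)" unfolding h(2) by simp
      finally have *: "s *\<^sub>R exponent_vector (fst c) + real k *\<^sub>R w = s *\<^sub>R exponent_vector (fst h)" .
      have "real (snd c + k * snd a) = real (snd h + k * snd b)" using h(3) by simp
      then have **: "real (snd c) + real k * (real (snd a) - real (snd b)) = real (snd h)"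
        by (simp add: algebra_simps)
      have "nat_feasible L (s *\<^sub>R exponent_vector (fst h)) (real (snd h))"
        using h(1) by (auto simp: feasible_exponents_def)
      then show ?thesis unfolding * ** by (rule nat_feasible_imp_real_feasible)
    qed
    \<comment> \<open>The contribution of \<open>c\<close> disappears in the limit; this places the
      difference of \<open>a\<close> and \<open>b\<close> in the real cone.\<close>
    have feas: "real_feasible L w (real (snd a) - real (snd b))"
      using lim by (rule real_feasible_limit)
    then have snd_le: "snd b \<le> snd a" using real_feasible_nonneg by fastforce
    \<comment> \<open>Membership in the cone need not bound exponents from below: for
      \<open>s = -1\<close> it only bounds them from above. The bound comes from \<open>h\<close>
      having natural exponents: a negative difference at \<open>i\<close> would, after more than
      \<open>lookup (fst c) i\<close> steps, exceed what \<open>c\<close> can compensate.\<close>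
    have fst_le: "lookup (fst b) i \<le> lookup (fst a) i" for i
    proof (rule ccontr)
      assume less: "\<not> lookup (fst b) i \<le> lookup (fst a) i"
      let ?k = "Suc (lookup (fst c) i)"
      obtain h where "h \<in> ?M" and "exponent_vector (fst c) + real ?k *\<^sub>R exponent_vector (fst a)
          = exponent_vector (fst h) + real ?k *\<^sub>R exponent_vector (fst b)"
        using eqs[of ?k] by blast
      from arg_cong[OF this(2), of "\<lambda>v. v $ i"]
      have "real (lookup (fst c) i + ?k * lookup (fst a) i)
          = real (lookup (fst h) i + ?k * lookup (fst b) i)"
        by (simp only: exponent_vector_nth vector_add_component vector_scaleR_component
            of_nat_add of_nat_mult real_scaleR_def)
      then have "?k * lookup (fst b) i \<le> lookup (fst c) i + ?k * lookup (fst a) i"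
        unfolding of_nat_eq_iff by linarith
      moreover have "?k * Suc (lookup (fst a) i) \<le> ?k * lookup (fst b) i"
        using less by (intro mult_le_mono2) simp
      ultimately show False by simp
    qed
    define m where "m = (fst a - fst b, snd a - snd b)"
    have "fst a = fst a - fst b + fst b"
      using fst_le by (intro poly_mapping_eqI) (simp add: lookup_add lookup_minus)
    then have am: "a = m + b" using snd_le by (simp add: m_def prod_eq_iff)
    then have "exponent_vector (fst a) = exponent_vector (fst m) + exponent_vector (fst b)"
      by (simp only: exponent_vector_add fst_add)
    then have w: "w = s *\<^sub>R exponent_vector (fst m)" by (simp add: w_def)
    have "w \<in> int_lattice" using s by (simp add: w int_lattice_def exponent_vector_nth)
    moreover have "real (snd a) - real (snd b) = real (snd m)" using snd_le by (simp add: m_def)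
    ultimately have "nat_feasible L w (real (snd m))"
      using dec feas unfolding decomposable_def by simp
    then have "m \<in> ?M" by (auto simp: feasible_exponents_def w)
    with am show "\<exists>m\<in>?M. a = m + b" by blast
  qed
  then show "normal_domain (monomial_algebra ?M :: ('n, 'k) mpoly_ring poly set)"
    by (intro completely_saturated_imp_normal zero_in_feasible_exponents feasible_exponents_add)
next
  let ?M = "feasible_exponents s L"
  assume normal: "normal_domain (monomial_algebra ?M :: ('n, 'k) mpoly_ring poly set)"
  show "decomposable L"
    unfolding decomposable_def
  proof (intro ballI allI impI)
    fix w :: "real^'n::{finite,linorder}" and b :: nat
    assume w: "w \<in> int_lattice" and "real_feasible L w (real b)"
    then obtain y where y: "0 \<le> y" "y \<bullet> 1 = real b" "L *v y \<le> w"
      unfolding real_feasible_def by blast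
    obtain a where a: "s *\<^sub>R exponent_vector a \<le> w" "L *v y \<le> s *\<^sub>R exponent_vector a"
      using reduce[OF w y(1,3)] by blast
    have feas: "real_feasible L (s *\<^sub>R exponent_vector a) (real b)"
      unfolding real_feasible_def using y a by blast
    have "s *\<^sub>R exponent_vector a \<in> int_lattice"
      using s by (simp add: int_lattice_def exponent_vector_nth)
    then obtain k where k: "k > 0" "nat_feasible L (real k *\<^sub>R s *\<^sub>R exponent_vector a) (real (k * b))"
      using nat_feasible_multiple[OF L _ feas] by blast
    have "(\<Sum>i<k. (a, b)) = ((\<Sum>i<k. a), k * b)"
      using fst_sum_const[of "(a, b)" k] snd_sum_const[of "(a, b)" k] by (simp add: prod_eq_iff)
    then have kM: "(\<Sum>i<k. (a, b)) \<in> ?M"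
      using k(2) by (simp add: feasible_exponents_def exponent_vector_sum_const mult.commute)
    obtain p q where "p \<in> ?M" "q \<in> ?M" "p = (a, b) + q" using group[OF feas] by blast
    then have "(a, b) \<in> ?M"
      using normal_imp_saturated[OF zero_in_feasible_exponents feasible_exponents_add normal _ _ _ k(1) kM]
      by blast
    then show "nat_feasible L w (real b)"
      using a(1) unfolding feasible_exponents_def nat_feasible_def by (auto intro: order.trans)
  qed
qed

section \<open>The Rees algebra\<close>

lemma module_times: "module ((*) :: 'a::comm_ring_1 \<Rightarrow> 'a \<Rightarrow> 'a)"
  by standard (simp_all add: algebra_simps)

lemma xpow_eq_single:
  "xpow v = (Poly_Mapping.single (vector_exponent v) 1 :: ('n::{finite,linorder}, 'k::field) mpoly_ring)"
proof -
  have pow: "mvar i ^ n = (Poly_Mapping.single (Poly_Mapping.single i n) 1 :: ('n, 'k) mpoly_ring)" for i :: 'n and n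
    by (induction n) (simp_all add: mvar_def mult_single flip: single_add)
  have "xpow v = (Poly_Mapping.single (\<Sum>i\<in>UNIV. Poly_Mapping.single i (v $ i)) 1 :: ('n, 'k) mpoly_ring)"
  proof -
    have "(\<Prod>i\<in>J. mvar i ^ (v $ i)) = (Poly_Mapping.single (\<Sum>i\<in>J. Poly_Mapping.single i (v $ i)) 1 :: ('n, 'k) mpoly_ring)"
      if "finite J" for J
      using that by (induction J) (simp_all add: pow mult_single)
    then show ?thesis by (simp add: xpow_def)
  qed
  moreover have "(\<Sum>i\<in>UNIV. Poly_Mapping.single i (v $ i)) = vector_exponent v"
    by (rule poly_mapping_eqI) (simp add: lookup_sum lookup_vector_exponent lookup_single when_def)
  ultimately show ?thesis by simp
qed

lemma sum_single_keys: "p = (\<Sum>a\<in>keys p. Poly_Mapping.single a (lookup p a))"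
  by (rule poly_mapping_eqI) (auto simp: lookup_sum lookup_single when_def in_keys_iff)

lemma exponent_diff:
  assumes "\<And>i. lookup b i \<le> lookup a i"
  shows "a = (b :: 'n \<Rightarrow>\<^sub>0 nat) + (a - b)"
  using assms by (intro poly_mapping_eqI) (simp add: lookup_add lookup_minus)

lemma exponent_vector_diff:
  assumes "\<And>i. lookup b i \<le> lookup a i"
  shows "exponent_vector (a - b) = exponent_vector a - exponent_vector b"
  using exponent_vector_add[of b "a - b"] exponent_diff[OF assms] by simp

lemma feasible_exponents_cons:
  assumes "(a, k) \<in> feasible_exponents s L" "column j L \<le> s *\<^sub>R exponent_vector b"
  shows "(b + a, Suc k) \<in> feasible_exponents s L"
proof -
  have "(b, 1) \<in> feasible_exponents s L"
    using assms(2) unfolding feasible_exponents_def nat_feasible_def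
    by (auto simp: matrix_vector_mult_axis axis_inner_one intro!: bexI[OF _ axis_in_nat_vectors[of j]])
  from feasible_exponents_add[OF this assms(1)] show ?thesis by simp
qed

lemma feasible_exponents_Suc:
  assumes "(a, Suc k) \<in> feasible_exponents s L"
  obtains j u where "u \<in> nat_vectors" "u \<bullet> 1 = real k" "L *v u + column j L \<le> s *\<^sub>R exponent_vector a"
proof -
  obtain u where u: "u \<in> nat_vectors" "u \<bullet> 1 = real (Suc k)" "L *v u \<le> s *\<^sub>R exponent_vector a"
    using assms unfolding feasible_exponents_def nat_feasible_def by blast
  obtain j v where "v \<in> nat_vectors" "u = v + axis j 1" "v \<bullet> 1 = real k"
    using nat_vectors_pred[OF u(1,2)] .
  with u(3) that[of v j] show ?thesis
    by (simp add: matrix_vector_right_distrib matrix_vector_mult_axis)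
qed

text \<open>A natural vector of sum 0 vanishes. For \<open>s = 1\<close> every exponent satisfies
  the condition, so the degree 0 part is the polynomial ring; for \<open>s = -1\<close> only the
  zero exponent does, so it is the field.\<close>

lemma feasible_exponents_zero_iff:
  "(a, 0) \<in> feasible_exponents s L \<longleftrightarrow> 0 \<le> s *\<^sub>R exponent_vector a"
proof -
  have "u = 0" if "u \<in> nat_vectors" "u \<bullet> 1 = 0" for u :: "real^'b"
    using that sum_nonneg_eq_0_iff[of UNIV "\<lambda>i. u $ i"]
    by (simp add: nat_vectors_iff less_eq_vec_def inner_one vec_eq_iff)
  then have "nat_feasible L w 0 \<longleftrightarrow> 0 \<le> w" for w
    unfolding nat_feasible_def using zero_in_nat_vectors
    by (metis inner_zero_left matrix_vector_mult_0_right)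
  then show ?thesis by (simp add: feasible_exponents_def)
qed

lemma column_real_matrix: "column j (real_matrix A) = exponent_vector (vector_exponent (column j A))"
  by (simp add: vec_eq_iff column_def real_matrix_def exponent_vector_nth lookup_vector_exponent)

text \<open>Induction on \<open>k\<close>: the right-hand side is an ideal that contains the
  products of the previous power with \<open>I\<close>, and conversely each of its terms has a
  generator as a factor, found by splitting off a column.\<close>

lemma ideal_power_monomial:
  fixes A :: "nat^'q::finite^'n::{finite,linorder}" and I :: "('n, 'k::field) mpoly_ring set"
  assumes I: "I = ideal_generated (range (\<lambda>j. xpow (column j A)))"
  shows "ideal_power I k = {p. \<forall>a\<in>keys p. (a, k) \<in> feasible_exponents 1 (real_matrix A)}"
proof (induction k)
  case 0
  have "0 \<le> exponent_vector a" for a :: "'n \<Rightarrow>\<^sub>0 nat"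
    by (simp add: less_eq_vec_def exponent_vector_nth)
  then show ?case by (simp add: feasible_exponents_zero_iff)
next
  case (Suc k)
  let ?M = "feasible_exponents 1 (real_matrix A)"
  let ?J = "\<lambda>k. {p :: ('n, 'k) mpoly_ring. \<forall>a\<in>keys p. (a, k) \<in> ?M}"
  let ?P = "{a * b |a b. a \<in> I \<and> b \<in> ideal_power I k}"
  interpret m: module "(*) :: ('n, 'k) mpoly_ring \<Rightarrow> _" by (rule module_times)
  \<comment> \<open>Multiplying by any monomial of degree 0 in t stays inside, so the set is an
    ideal and not just an additive group.\<close>
  have up: "(b + a, k) \<in> ?M" if "(a, k) \<in> ?M" for a b k
  proof -
    have "(b, 0) \<in> ?M"
      by (simp add: feasible_exponents_zero_iff less_eq_vec_def exponent_vector_nth)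
    from feasible_exponents_add[OF this that] show ?thesis by simp
  qed
  have sub: "m.subspace (?J k)" for k
    unfolding m.subspace_def
  proof (intro conjI ballI allI)
    fix p q assume "p \<in> ?J k" "q \<in> ?J k"
    then show "p + q \<in> ?J k" using keys_add[of p q] by blast
  next
    fix c p assume "p \<in> ?J k"
    then show "c * p \<in> ?J k" using keys_mult[of c p] up by fastforce
  qed simp
  have "xpow (column j A) \<in> ?J 1" for j
    using feasible_exponents_cons[of 0 0 1 "real_matrix A" j "vector_exponent (column j A)"]
    by (simp add: xpow_eq_single column_real_matrix feasible_exponents_zero_iff exponent_vector_zero)
  then have I_sub: "I \<subseteq> ?J 1"
    unfolding I ideal_generated_def by (intro m.span_minimal sub) blast
  show ?case
    unfolding ideal_power.simps ideal_generated_def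
  proof (rule antisym)
    have "a * b \<in> ?J (Suc k)" if "a \<in> I" "b \<in> ideal_power I k" for a b
    proof -
      have "(c + d, Suc k) \<in> ?M" if "c \<in> keys a" "d \<in> keys b" for c d
      proof -
        have "(c, 1) \<in> ?M" "(d, k) \<in> ?M" using that I_sub \<open>a \<in> I\<close> \<open>b \<in> ideal_power I k\<close> Suc by auto
        from feasible_exponents_add[OF this] show ?thesis by simp
      qed
      then show ?thesis using keys_mult[of a b] by blast
    qed
    then show "m.span ?P \<subseteq> ?J (Suc k)" by (intro m.span_minimal sub) blast
    show "?J (Suc k) \<subseteq> m.span ?P"
    proof
      fix p assume p: "p \<in> ?J (Suc k)"
      have "Poly_Mapping.single a c \<in> m.span ?P" if "(a, Suc k) \<in> ?M" for a c
      proof -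
        obtain j u where u: "u \<in> nat_vectors" "u \<bullet> 1 = real k"
          "real_matrix A *v u + column j (real_matrix A) \<le> 1 *\<^sub>R exponent_vector a"
          using feasible_exponents_Suc[OF \<open>(a, Suc k) \<in> ?M\<close>] .
        let ?b = "vector_exponent (column j A)"
        \<comment> \<open>The remaining columns contribute nonnegatively, so column \<open>j\<close>
          alone lies below \<open>a\<close> and the truncating subtraction \<open>a - ?b\<close> is
          a true difference.\<close>
        have "0 \<le> real_matrix A *v u"
          using matrix_vector_mult_mono[OF real_matrix_nonneg, of 0 u A] u(1) by (simp add: nat_vectors_iff)
        then have "exponent_vector ?b \<le> exponent_vector a"
          using u(3) unfolding column_real_matrix by (simp add: less_eq_vec_def) (smt (verit, best))
        then have le: "\<And>i. lookup ?b i \<le> lookup a i"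
          by (simp add: less_eq_vec_def exponent_vector_nth)
        have "(a - ?b, k) \<in> ?M"
          using u unfolding feasible_exponents_def nat_feasible_def column_real_matrix
          by (auto simp: exponent_vector_diff[OF le] le_diff_eq intro!: bexI[of _ u])
        then have "Poly_Mapping.single (a - ?b) c \<in> ideal_power I k"
          using Suc by simp
        moreover have "xpow (column j A) \<in> I"
          unfolding I ideal_generated_def by (intro m.span_base) blast
        ultimately have "xpow (column j A) * Poly_Mapping.single (a - ?b) c \<in> m.span ?P"
          by (intro m.span_base) blast
        then show ?thesis
          using exponent_diff[OF le] by (simp add: xpow_eq_single mult_single)
      qed
      then have "(\<Sum>a\<in>keys p. Poly_Mapping.single a (lookup p a)) \<in> m.span ?P"
        using p by (intro m.span_sum) auto
      then show "p \<in> m.span ?P" using sum_single_keys[of p] by simp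
    qed
  qed
qed

lemma rees_algebra_eq_monomial_algebra:
  fixes A :: "nat^'q::finite^'n::{finite,linorder}" and I :: "('n, 'k::field) mpoly_ring set"
  assumes "I = ideal_generated (range (\<lambda>j. xpow (column j A)))"
  shows "rees_algebra I = monomial_algebra (feasible_exponents 1 (real_matrix A))"
  unfolding rees_algebra_def monomial_algebra_def ideal_power_monomial[OF assms]
  by (auto simp: exponents_def in_keys_iff)

section \<open>The dual algebra\<close>

lemma is_subring_subring_generated: "is_subring (subring_generated G)"
  unfolding is_subring_def by (auto intro: subring_generated.intros)

lemma monom_xpow: "monom (xpow v) k = monomial 1 (vector_exponent v, k)"
  by (simp add: monomial_def xpow_eq_single)

text \<open>An exponent below a sum of \<open>k\<close> columns is a sum of \<open>k\<close>
  exponents, each below one of these columns, so its monomial is a product of \<open>k\<close>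
  generators.\<close>

lemma K_subalgebra_eq_monomial_algebra:
  fixes B :: "nat^'q::finite^'n::{finite,linorder}" and W :: "(nat^'n::{finite,linorder}) set"
  assumes W: "W = {\<alpha>. \<exists>j. \<alpha> \<le> column j B}"
  shows "K_subalgebra ((\<lambda>w. monom (xpow w) 1) ` W)
    = (monomial_algebra (feasible_exponents (-1) (- real_matrix B)) :: ('n, 'k::field) mpoly_ring poly set)"
proof
  let ?M = "feasible_exponents (-1) (- real_matrix B)"
  let ?S = "monomial_algebra ?M :: ('n, 'k) mpoly_ring poly set"
  let ?G = "range (\<lambda>c. [:mconst c:]) \<union> (\<lambda>w. monom (xpow w) 1) ` W :: ('n, 'k) mpoly_ring poly set"
  have S: "is_subring ?S"
    by (intro is_subring_monomial_algebra zero_in_feasible_exponents feasible_exponents_add)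
  have const: "[:mconst c:] = (monomial c 0 :: ('n, 'k) mpoly_ring poly)" for c
    by (simp add: monomial_def zero_prod_def monom_0 mconst_def)
  have dominated: "(b, Suc 0) \<in> ?M" if "\<And>i. lookup b i \<le> column j B $ i" for b j
  proof -
    have "column j (- real_matrix B) \<le> (-1) *\<^sub>R exponent_vector b"
      using that by (simp add: less_eq_vec_def column_def real_matrix_def exponent_vector_nth)
    from feasible_exponents_cons[OF _ this, of 0 0] show ?thesis
      by (simp add: feasible_exponents_zero_iff exponent_vector_zero)
  qed
  have "p \<in> ?S" if "p \<in> subring_generated ?G" for p
    using that
  proof induction
    case (gen p)
    then consider c where "p = monomial c 0" | w where "w \<in> W" "p = monom (xpow w) 1"
      unfolding const by blast
    then show ?case
    proof cases
      case 1 then show ?thesis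
        using zero_in_feasible_exponents[of "-1" "- real_matrix B"]
        by (simp add: monomial_algebra_def exponents_monomial)
    next
      case 2
      then obtain j where "w \<le> column j B" using W by blast
      then have "(vector_exponent w, Suc 0) \<in> ?M"
        by (intro dominated[of _ j]) (simp add: lookup_vector_exponent less_eq_vec_def)
      then show ?thesis by (simp add: 2 monom_xpow monomial_algebra_def exponents_monomial)
    qed
  qed (auto intro: is_subringD[OF S])
  then show "K_subalgebra ((\<lambda>w. monom (xpow w) 1) ` W) \<subseteq> ?S"
    unfolding K_subalgebra_def by blast
  note R = is_subring_subring_generated[of ?G]
  have mono: "monomial 1 (a, k) \<in> subring_generated ?G" if "(a, k) \<in> ?M" for a k
    using that
  proof (induction k arbitrary: a)
    case 0
    then have "a = 0"
      by (intro poly_mapping_eqI) (simp add: feasible_exponents_zero_iff less_eq_vec_def exponent_vector_nth)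
    then have "monomial 1 (a, 0) = (1 :: ('n, 'k) mpoly_ring poly)"
      using monomial_one unfolding zero_prod_def by simp
    then show ?case by (simp add: subring_generated.one)
  next
    case (Suc k)
    obtain j u where u: "u \<in> nat_vectors" "u \<bullet> 1 = real k"
      "- real_matrix B *v u + column j (- real_matrix B) \<le> -1 *\<^sub>R exponent_vector a"
      using feasible_exponents_Suc[OF Suc.prems] .
    \<comment> \<open>The largest part of \<open>a\<close> below column \<open>j\<close>. The rest
      is the positive part of \<open>a\<close> minus that column, and stays below \<open>B u\<close>
      because \<open>B u\<close> is nonnegative.\<close>
    define w :: "nat^'n::{finite,linorder}" where "w = (\<chi> i. min (lookup a i) (column j B $ i))"
    let ?b = "vector_exponent w"
    have le: "\<And>i. lookup ?b i \<le> lookup a i" by (simp add: w_def lookup_vector_exponent)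
    have "0 \<le> real_matrix B *v u"
      using matrix_vector_mult_mono[OF real_matrix_nonneg, of 0 u B] u(1) by (simp add: nat_vectors_iff)
    moreover have "real (lookup a i) \<le> real (B $ i $ j) + (real_matrix B *v u) $ i" for i
      using u(3) by (simp add: less_eq_vec_def uminus_matrix_vector_mult column_def
          exponent_vector_nth real_matrix_def algebra_simps)
    ultimately have "real (lookup (a - ?b) i) \<le> (real_matrix B *v u) $ i" for i
      by (cases "lookup a i \<le> B $ i $ j")
        (auto simp: less_eq_vec_def lookup_minus lookup_vector_exponent w_def column_def of_nat_diff diff_le_eq add.commute)
    then have "exponent_vector (a - ?b) \<le> real_matrix B *v u"
      by (simp add: less_eq_vec_def exponent_vector_nth)
    then have "(a - ?b, k) \<in> ?M"
      using u(1,2) unfolding feasible_exponents_def nat_feasible_def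
      by (auto simp: uminus_matrix_vector_mult intro!: bexI[of _ u])
    then have "monomial 1 (a - ?b, k) \<in> subring_generated ?G" by (rule Suc.IH)
    moreover have "w \<le> column j B" by (simp add: w_def less_eq_vec_def)
    then have "w \<in> W" unfolding W by blast
    then have "monomial 1 (?b, 1) \<in> subring_generated ?G"
      unfolding monom_xpow[symmetric] by (intro subring_generated.gen) blast
    ultimately have "monomial 1 (?b, 1) * monomial 1 (a - ?b, k) \<in> subring_generated ?G"
      by (intro subring_generated.mult)
    then show ?case using exponent_diff[OF le] by (simp add: monomial_mult)
  qed
  show "?S \<subseteq> K_subalgebra ((\<lambda>w. monom (xpow w) 1) ` W)"
  proof
    fix p assume p: "p \<in> ?S"
    have "monomial c (a, k) \<in> subring_generated ?G" if "(a, k) \<in> ?M" for c a k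
    proof -
      have "monomial c 0 * monomial 1 (a, k) \<in> subring_generated ?G"
        by (intro subring_generated.mult mono that subring_generated.gen) (auto simp flip: const)
      then show ?thesis by (simp add: monomial_mult)
    qed
    then have "(\<Sum>(a, k)\<in>exponents p. monomial (lookup (coeff p k) a) (a, k)) \<in> subring_generated ?G"
      using p unfolding monomial_algebra_def by (intro is_subring_sum[OF R]) auto
    then show "p \<in> K_subalgebra ((\<lambda>w. monom (xpow w) 1) ` W)"
      using sum_monomials[of p] unfolding K_subalgebra_def by simp
  qed
qed

section \<open>The equivalences\<close>

lemma normal_rees_iff_decomposable:
  fixes A :: "nat^'q::finite^'n::{finite,linorder}"
  assumes A: "\<forall>i j. A $ i $ j \<le> 1"
  shows "normal_domain (monomial_algebra (feasible_exponents 1 (real_matrix A)) :: ('n, 'k::field) mpoly_ring poly set)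
    \<longleftrightarrow> decomposable (real_matrix A)"
proof (rule normal_iff_decomposable)
  show "\<forall>i j. real_matrix A $ i $ j \<in> \<int>" "(1::real) \<in> \<int>" by (simp_all add: real_matrix_def)
next
  fix w :: "real^'n::{finite,linorder}" and y
  assume w: "w \<in> int_lattice" and y: "0 \<le> y" "real_matrix A *v y \<le> w"
  \<comment> \<open>Here \<open>w\<close> dominates a nonnegative vector and is integral, so it
    already is an exponent vector.\<close>
  have "0 \<le> real_matrix A *v y"
    using matrix_vector_mult_mono[OF real_matrix_nonneg y(1)] by simp
  with y(2) have "0 \<le> w" by (rule order.trans[rotated])
  then have "\<forall>i. w $ i \<in> \<nat>" using w by (simp add: int_lattice_def less_eq_vec_def Nats_altdef2)
  then have "\<forall>i. real (nat \<lfloor>w $ i\<rfloor>) = w $ i" by (metis Nats_cases floor_of_nat nat_int)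
  then have "exponent_vector (vector_exponent (\<chi> i. nat \<lfloor>w $ i\<rfloor>)) = w"
    by (simp add: vec_eq_iff exponent_vector_nth lookup_vector_exponent)
  with y(2) show "\<exists>a. 1 *\<^sub>R exponent_vector a \<le> w \<and> real_matrix A *v y \<le> 1 *\<^sub>R exponent_vector a"
    by (metis order.refl scaleR_one)
next
  fix a :: "'n \<Rightarrow>\<^sub>0 nat" and k
  let ?M = "feasible_exponents 1 (real_matrix A)"
  \<comment> \<open>Entries at most 1 make the vector with all entries \<open>k\<close> dominate
    \<open>k\<close> times any column, so adding it to \<open>a\<close> gives a point of degree
    \<open>k\<close>, while the vector itself has degree 0.\<close>
  let ?b = "vector_exponent (\<chi> i. k)"
  have "(a + ?b, k) \<in> ?M"
    unfolding feasible_exponents_def nat_feasible_def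
  proof (clarsimp, intro bexI conjI)
    let ?u = "real k *\<^sub>R axis (SOME j. True) 1 :: real^'q"
    show "?u \<in> nat_vectors" by (simp add: nat_vectors_def axis_def)
    show "?u \<bullet> 1 = real k" by (simp add: axis_inner_one)
    have "real k * real (A $ i $ j) \<le> real (lookup a i) + real k" for i j
      using A mult_left_mono[of "real (A $ i $ j)" 1 "real k"] by (simp add: add_increasing)
    then show "real_matrix A *v ?u \<le> exponent_vector (a + ?b)"
      by (simp add: matrix_vector_mult_scaleR matrix_vector_mult_axis column_def real_matrix_def
          less_eq_vec_def exponent_vector_nth lookup_add lookup_vector_exponent)
  qed
  moreover have "(?b, 0) \<in> ?M"
    by (simp add: feasible_exponents_zero_iff less_eq_vec_def exponent_vector_nth)
  ultimately show "\<exists>p\<in>?M. \<exists>q\<in>?M. p = (a, k) + q"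
    by (intro bexI[of _ "(a + ?b, k)"] bexI[of _ "(?b, 0)"]) simp_all
qed

lemma normal_dual_iff_decomposable:
  fixes B :: "nat^'q::finite^'n::{finite,linorder}"
  shows "normal_domain (monomial_algebra (feasible_exponents (-1) (- real_matrix B)) :: ('n, 'k::field) mpoly_ring poly set)
    \<longleftrightarrow> decomposable (- real_matrix B)"
proof (rule normal_iff_decomposable)
  show "\<forall>i j. (- real_matrix B) $ i $ j \<in> \<int>" "(-1::real) \<in> \<int>" by (simp_all add: real_matrix_def)
next
  fix w :: "real^'n::{finite,linorder}" and y
  assume w: "w \<in> int_lattice" and y: "0 \<le> y" "- real_matrix B *v y \<le> w"
  have By: "0 \<le> real_matrix B *v y"
    using matrix_vector_mult_mono[OF real_matrix_nonneg y(1)] by simp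
  \<comment> \<open>The exponent is the positive part of \<open>- w\<close>; its negative is the
    minimum of \<open>w\<close> and 0, which still dominates \<open>- real_matrix B *v y\<close>
    since the latter is at most 0.\<close>
  let ?a = "vector_exponent (\<chi> i. nat \<lfloor>- w $ i\<rfloor>)"
  have "(-1 *\<^sub>R exponent_vector ?a) $ i = min (w $ i) 0" for i
  proof -
    have "w $ i \<in> \<int>" using w by (simp add: int_lattice_def)
    then show ?thesis
      by (auto elim!: Ints_cases simp: exponent_vector_nth lookup_vector_exponent min_def simp flip: of_int_minus)
  qed
  then show "\<exists>a. -1 *\<^sub>R exponent_vector a \<le> w \<and> - real_matrix B *v y \<le> -1 *\<^sub>R exponent_vector a"
    using y(2) By by (intro exI[of _ ?a]) (simp add: less_eq_vec_def uminus_matrix_vector_mult)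
next
  fix a :: "'n \<Rightarrow>\<^sub>0 nat" and k
  let ?L = "- real_matrix B"
  let ?M = "feasible_exponents (-1) ?L"
  assume "real_feasible ?L (-1 *\<^sub>R exponent_vector a) (real k)"
  then have "real_feasible ?L (- exponent_vector a) (real k)" by simp
  then obtain y where y: "0 \<le> y" "y \<bullet> 1 = real k" "exponent_vector a \<le> real_matrix B *v y"
    unfolding real_feasible_uminus by blast
  \<comment> \<open>Rounding up keeps \<open>a\<close> below \<open>B u\<close> but may raise the
    sum from \<open>k\<close> to some \<open>m\<close>. The surplus is removed by the monomial
    t^(m-k), which belongs to the algebra because the zero exponent lies below every column.\<close>
  define u :: "real^'q" where "u = (\<chi> j. real (nat \<lceil>y $ j\<rceil>))"
  have u: "u \<in> nat_vectors" "y \<le> u" by (auto simp: u_def nat_vectors_def less_eq_vec_def real_nat_ceiling_ge)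
  have "exponent_vector a \<le> real_matrix B *v u"
    using y(3) matrix_vector_mult_mono[OF real_matrix_nonneg u(2)] by (rule order.trans)
  moreover obtain m where m: "u \<bullet> 1 = real m"
    using nat_vectors_inner_one[OF u(1)] by (auto elim: Nats_cases)
  ultimately have "(a, m) \<in> ?M"
    using u(1) by (auto simp: feasible_exponents_def nat_feasible_uminus)
  moreover have "(0, n) \<in> ?M" for n
    unfolding feasible_exponents_def nat_feasible_def
  proof (clarsimp, intro bexI conjI)
    let ?u = "real n *\<^sub>R axis (SOME j. True) 1 :: real^'q"
    show un: "?u \<in> nat_vectors" by (simp add: nat_vectors_def axis_def)
    show "?u \<bullet> 1 = real n" by (simp add: axis_inner_one)
    show "?L *v ?u \<le> - exponent_vector 0"
      using matrix_vector_mult_mono[OF real_matrix_nonneg, of 0 ?u B] un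
      by (simp add: nat_vectors_iff uminus_matrix_vector_mult exponent_vector_zero)
  qed
  moreover have "k \<le> m"
  proof -
    have "(\<Sum>j\<in>UNIV. y $ j) \<le> (\<Sum>j\<in>UNIV. u $ j)"
      using u(2) by (intro sum_mono) (simp add: less_eq_vec_def)
    then show ?thesis using y(2) m by (simp add: inner_one)
  qed
  ultimately show "\<exists>p\<in>?M. \<exists>q\<in>?M. p = (a, k) + q"
    by (intro bexI[of _ "(a, m)"] bexI[of _ "(0, m - k)"]) simp_all
qed

theorem theorem1p2p11:
  fixes E :: "'n::{finite,linorder} set set"
    and A :: "nat^'q::finite^'n::{finite,linorder}"
    and I :: "('n, 'k::field) mpoly_ring set"
    and W :: "(nat^'n::{finite,linorder}) set"
    and S :: "('n, 'k) mpoly_ring poly set"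
    and H :: "(real^('n option)) set"
  assumes "clutter UNIV E"
    and "is_incidence_matrix E A"
    and "\<forall>i. row i A \<noteq> 0"
    and "\<forall>j. column j A \<noteq> 0"
    and "I = ideal_generated (range (\<lambda>j. xpow (column j A)))"
    and "W = {\<alpha>. \<exists>j. \<alpha> \<le> column j (dual_matrix A)}"
    and "S = K_subalgebra ((\<lambda>w. monom (xpow w) 1) ` W)"
    and "H = range (\<lambda>i. - axis (Some i) 1)
             \<union> range (\<lambda>j. append_one (column j (dual_matrix A)))"
  shows "(normal_domain (rees_algebra I) \<longleftrightarrow> normal_domain S)
    \<and> (normal_domain S \<longleftrightarrow> hilbert_basis H)
    \<and> (hilbert_basis H \<longleftrightarrow> integer_rounding_ge A)
    \<and> (integer_rounding_ge A \<longleftrightarrow> integer_rounding_le (dual_matrix A))"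
proof -
  let ?D = "real_matrix (dual_matrix A)"
  have A: "\<forall>i j. A $ i $ j \<le> 1"
    using assms(2) by (auto simp: is_incidence_matrix_def)
  \<comment> \<open>The Rees algebra and the covering system lead to the property for
    \<open>A\<close>, the other three conditions to the one for the negated dual matrix; this
    equivalence joins them.\<close>
  note dual = decomposable_dual_matrix[OF A]
  have "normal_domain (rees_algebra I) \<longleftrightarrow> decomposable (real_matrix A)"
    unfolding rees_algebra_eq_monomial_algebra[OF assms(5)] by (rule normal_rees_iff_decomposable[OF A])
  moreover have "normal_domain S \<longleftrightarrow> decomposable (- ?D)"
    unfolding assms(7) K_subalgebra_eq_monomial_algebra[OF assms(6)]
    by (rule normal_dual_iff_decomposable)
  moreover have "hilbert_basis H \<longleftrightarrow> decomposable (- ?D)"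
    unfolding assms(8) by (rule hilbert_basis_iff_decomposable)
  ultimately show ?thesis
    using dual integer_rounding_ge_iff_decomposable[OF assms(4)]
      integer_rounding_le_iff_decomposable[of "dual_matrix A"] by blast
qed

end
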